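(* Let $\mathcal{T}\subset(-\infty,\infty)$ be an open interval and let $(Z_t)_{t\in\mathcal{T}}$ be a (non-homogeneous) Markov process with univariate distributions $\pi_t$. Assume that there is a family of Borel sets $\{M_t:t\in\mathcal{T}\}$ such that $\pi_t(M_t)=1$ and that $(Z_t)$ has transition probabilities $P_{s,t}(x,dy)$ defined for $x\in M_s$. Assume that: (i) the transition probabilities $P_{s,t}(x,dy)$ are absolutely continuous with respect to the univariate laws $\pi_t$: for $x\in M_s$ and $s<t$, $$P_{s,t}(x,dy)=p(s,x;t,y)\,\pi_t(dy),$$ where $(x,y)\mapsto p(s,x;t,y)$ is a measurable function $M_s\times M_t\to[0,\infty)$; (ii) there are $r<v$ in $\mathcal{T}$ and a pair $(z_r,z_v)\in M_r\times M_v$ such that $0<p(r,z_r;v,z_v)<\infty$, and for any $\varepsilon>0$ $$\lim_{t\to r^+}\int_{\{y:|y-z_r|>\varepsilon\}}p(r,z_r;t,y)\,p(t,y;v,z_v)\,\pi_t(dy)=0,$$ $$\lim_{t\to v^-}\int_{\{y:|y-z_v|>\varepsilon\}}p(r,z_r;t,y)\,p(t,y;v,z_v)\,\pi_t(dy)=0.$$ Then there is a Markov process $(X_t)_{t\in(r,v)}$ which is a bridge between the points $(r,z_r)$ and $(v,z_v)$ of the process $(Z_t)$.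
   Context: **Bridge.** For $t_1<\dots<t_m$ in $\mathcal{T}$ write $Z_{\mathbf t}=(Z_{t_1},\dots,Z_{t_m})$, and similarly for other processes and other time vectors $\mathbf{s}$, $\mathbf{u}$. A stochastic process $(X_t)_{t\in(r,v)}$ is a bridge between points $(r,z_r)$ and $(v,z_v)$ of a process $(Z_t)_{t\in\mathcal{T}}$ such that $(r,v)\subset\mathcal{T}$, if: (1) $\lim_{t\to r^+}X_t=z_r$ and $\lim_{t\to v^-}X_t=z_v$ in probability; (2) for $r<t_1<\dots<t_m<v$ the distribution of the vector $X_{\mathbf t}$ is absolutely continuous with respect to the distribution of the vector $Z_{\mathbf t}$; (3) for $r<s_1<\dots<s_k<t_1<\dots<t_m<u_1<\dots<u_n<v$ and integrable function $g$, if $\mathbb{E}(g(Z_{\mathbf t})|Z_{\mathbf s},Z_{\mathbf u})=h(Z_{\mathbf s},Z_{\mathbf u})$, then $\mathbb{E}(g(X_{\mathbf t})|X_{\mathbf s},X_{\mathbf u})=h(X_{\mathbf s},X_{\mathbf u})$ (the equalities hold almost surely on the respective probability spaces).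
   Formalization: The formal theorem also assumes Chapman–Kolmogorov for the densities at (v,z_v): p(s,x;v,z_v)=∫p(s,x;t,y)p(t,y;v,z_v)π_t(dy) for r≤s<t<v, x∈M_s; without it the claim is false, since p(·,·;v,z_v) may be altered at the π_v-null point z_v. *)

theory Defs
  imports "HOL-Probability.Probability"
begin

text \<open>
  A real-valued process on the probability space \<open>\<Omega>\<close> is a function \<open>X :: real \<Rightarrow> 'a \<Rightarrow> real\<close>,
  of which only the values \<open>X t\<close> with \<open>t\<close> in the time set \<open>I\<close> matter.  An increasing vector of times
  \<open>t\<^sub>1 < \<dots> < t\<^sub>m\<close> is encoded by the finite set \<open>J = {t\<^sub>1, \<dots>, t\<^sub>m}\<close>, and the random vector
  \<open>(X t\<^sub>1, \<dots>, X t\<^sub>m)\<close> by \<open>at_times X J\<close>, a random element of \<open>PiM J (\<lambda>_. borel)\<close>.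
\<close>

definition at_times :: "(real \<Rightarrow> 'a \<Rightarrow> real) \<Rightarrow> real set \<Rightarrow> 'a \<Rightarrow> real \<Rightarrow> real" where
  "at_times X J \<omega> = (\<lambda>t\<in>J. X t \<omega>)"

text \<open>The \<open>\<sigma>\<close>-algebra \<open>\<sigma>(X t : t \<in> J)\<close>; the set \<open>J\<close> may be infinite.\<close>

definition sigma_gen :: "'a measure \<Rightarrow> (real \<Rightarrow> 'a \<Rightarrow> real) \<Rightarrow> real set \<Rightarrow> 'a measure" where
  "sigma_gen \<Omega> X J = vimage_algebra (space \<Omega>) (at_times X J) (PiM J (\<lambda>_. borel))"

definition real_process :: "'a measure \<Rightarrow> real set \<Rightarrow> (real \<Rightarrow> 'a \<Rightarrow> real) \<Rightarrow> bool" where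
  "real_process \<Omega> I X \<longleftrightarrow> prob_space \<Omega> \<and> (\<forall>t\<in>I. X t \<in> borel_measurable \<Omega>)"

definition markov_process :: "'a measure \<Rightarrow> real set \<Rightarrow> (real \<Rightarrow> 'a \<Rightarrow> real) \<Rightarrow> bool" where
  "markov_process \<Omega> I X \<longleftrightarrow>
     real_process \<Omega> I X \<and>
     (\<forall>s\<in>I. \<forall>t\<in>I. s < t \<longrightarrow> (\<forall>B\<in>sets borel. AE \<omega> in \<Omega>.
        real_cond_exp \<Omega> (sigma_gen \<Omega> X {u \<in> I. u \<le> s}) (\<lambda>\<omega>. indicator B (X t \<omega>)) \<omega> =
        real_cond_exp \<Omega> (sigma_gen \<Omega> X {s}) (\<lambda>\<omega>. indicator B (X t \<omega>)) \<omega>))"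

text \<open>
  \<open>P s t x\<close> is the law of \<open>Z t\<close> given \<open>Z s = x\<close>, defined for \<open>x \<in> M s\<close>.  As usual for transition
  probabilities, the Chapman-Kolmogorov equation is part of the notion and holds for every starting
  point in \<open>M s\<close>; for \<open>B = UNIV\<close> it says that \<open>P s t x\<close> is concentrated on \<open>M t\<close>, where the next
  kernel is defined (for \<open>t\<close> not the last time in \<open>I\<close>).
\<close>

definition transition_probabilities ::
  "'a measure \<Rightarrow> real set \<Rightarrow> (real \<Rightarrow> 'a \<Rightarrow> real) \<Rightarrow> (real \<Rightarrow> real set) \<Rightarrow>
   (real \<Rightarrow> real \<Rightarrow> real \<Rightarrow> real measure) \<Rightarrow> bool" where
  "transition_probabilities \<Omega> I Z M P \<longleftrightarrow>
     (\<forall>s\<in>I. \<forall>t\<in>I. s < t \<longrightarrow>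
        P s t \<in> restrict_space borel (M s) \<rightarrow>\<^sub>M prob_algebra borel \<and>
        (\<forall>B\<in>sets borel. AE \<omega> in \<Omega>.
           real_cond_exp \<Omega> (sigma_gen \<Omega> Z {u \<in> I. u \<le> s}) (\<lambda>\<omega>. indicator B (Z t \<omega>)) \<omega> =
           measure (P s t (Z s \<omega>)) B)) \<and>
     (\<forall>s\<in>I. \<forall>t\<in>I. \<forall>u\<in>I. s < t \<longrightarrow> t < u \<longrightarrow> (\<forall>x\<in>M s. \<forall>B\<in>sets borel.
        emeasure (P s u x) B = (\<integral>\<^sup>+y\<in>M t. emeasure (P t u y) B \<partial>P s t x)))"

text \<open>
  In the last clause the times in \<open>S\<close>, \<open>J\<close>, \<open>U\<close> are those of the vectors \<open>\<^bold>s\<close>, \<open>\<^bold>t\<close>, \<open>\<^bold>u\<close>, all three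
  of positive length.  Integrability is required of \<open>g(Z\<^sub>\<^bold>t)\<close> only.  \<open>real_cond_exp\<close> is the generalised
  conditional expectation \<open>E(f\<^sup>+|F) - E(f\<^sup>-|F)\<close>, so that the conclusion remains meaningful when
  \<open>g(X\<^sub>\<^bold>t)\<close> fails to be integrable: its conditional expectations are then still finite almost surely.
\<close>

definition is_bridge ::
  "'a measure \<Rightarrow> real set \<Rightarrow> (real \<Rightarrow> 'a \<Rightarrow> real) \<Rightarrow> real \<Rightarrow> real \<Rightarrow> real \<Rightarrow> real \<Rightarrow>
   'b measure \<Rightarrow> (real \<Rightarrow> 'b \<Rightarrow> real) \<Rightarrow> bool" where
  "is_bridge \<Omega> I Z r zr v zv N X \<longleftrightarrow>
     r < v \<and> {r<..<v} \<subseteq> I \<and> real_process N {r<..<v} X \<and>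
     (\<forall>\<epsilon>>0. ((\<lambda>t. measure N {\<omega> \<in> space N. \<bar>X t \<omega> - zr\<bar> > \<epsilon>}) \<longlongrightarrow> 0) (at_right r)) \<and>
     (\<forall>\<epsilon>>0. ((\<lambda>t. measure N {\<omega> \<in> space N. \<bar>X t \<omega> - zv\<bar> > \<epsilon>}) \<longlongrightarrow> 0) (at_left v)) \<and>
     (\<forall>J. finite J \<and> J \<noteq> {} \<and> J \<subseteq> {r<..<v} \<longrightarrow>
        absolutely_continuous
          (distr \<Omega> (PiM J (\<lambda>_. borel)) (at_times Z J))
          (distr N (PiM J (\<lambda>_. borel)) (at_times X J))) \<and>
     (\<forall>S J U g h.
        finite S \<and> finite J \<and> finite U \<and> S \<noteq> {} \<and> J \<noteq> {} \<and> U \<noteq> {} \<and>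
        S \<union> J \<union> U \<subseteq> {r<..<v} \<and>
        (\<forall>s\<in>S. \<forall>t\<in>J. s < t) \<and> (\<forall>t\<in>J. \<forall>u\<in>U. t < u) \<and>
        g \<in> borel_measurable (PiM J (\<lambda>_. borel)) \<and>
        h \<in> borel_measurable (PiM S (\<lambda>_. borel) \<Otimes>\<^sub>M PiM U (\<lambda>_. borel)) \<and>
        integrable \<Omega> (\<lambda>\<omega>. g (at_times Z J \<omega>)) \<and>
        (AE \<omega> in \<Omega>. real_cond_exp \<Omega> (sigma_gen \<Omega> Z (S \<union> U)) (\<lambda>\<omega>. g (at_times Z J \<omega>)) \<omega> =
                    (h (at_times Z S \<omega>, at_times Z U \<omega>) :: real)) \<longrightarrow>
        (AE \<omega> in N. real_cond_exp N (sigma_gen N X (S \<union> U)) (\<lambda>\<omega>. g (at_times X J \<omega>)) \<omega> =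
                    h (at_times X S \<omega>, at_times X U \<omega>)))"

end

theory Submission
  imports Defs
begin

text \<open>
  The bridge is \<open>Z\<close> under a change of measure: with \<open>\<alpha>\<^sub>a(x) = p(r, z\<^sub>r; a, x)\<close> and
  \<open>\<beta>\<^sub>b(y) = p(b, y; v, z\<^sub>v)\<close>, the law of \<open>(X\<^sub>t : t \<in> J)\<close> for a finite set \<open>J \<subseteq> [a, b]\<close> is the law of
  \<open>(Z\<^sub>t : t \<in> J)\<close> under \<open>\<alpha>\<^sub>a(Z\<^sub>a) \<beta>\<^sub>b(Z\<^sub>b) / p(r, z\<^sub>r; v, z\<^sub>v)\<close>.  Chapman-Kolmogorov at both ends makes this
  independent of \<open>a\<close> and \<open>b\<close>, so the laws form a projective family and the Daniell-Kolmogorov theorem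
  gives \<open>X\<close>.  Absolute continuity and the limits are then immediate.  Conditioning on times \<open>S\<close>
  before and \<open>U\<close> after \<open>J\<close> one may take \<open>a \<in> S\<close> and \<open>b \<in> U\<close>; the weight is then measurable with
  respect to the conditioning \<open>\<sigma>\<close>-algebra and leaves conditional expectations unchanged.  The Markov
  property is the \<open>h\<close>-transform formula for the kernels.
\<close>

section \<open>Generated \<open>\<sigma>\<close>-algebras\<close>

lemma space_sigma_gen [simp]: "space (sigma_gen \<Omega> X J) = space \<Omega>"
  by (simp add: sigma_gen_def)

lemma at_times_in_extensional [simp]: "at_times X J \<omega> \<in> extensional J"
  by (simp add: at_times_def)

lemma restrict_at_times: "K \<subseteq> J \<Longrightarrow> restrict (at_times X J \<omega>) K = at_times X K \<omega>"
  by (auto simp: at_times_def fun_eq_iff)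

text \<open>Cylinders generate the product \<open>\<sigma>\<close>-algebra, so laws are compared on
  them; as a product of one-time factors their indicator fits the integral identities for
  \<open>Z\<close> below.\<close>

lemma indicator_at_times_emb:
  assumes "finite K" "K \<subseteq> J"
  shows "indicator (prod_emb J (\<lambda>_. borel) K (PiE K A)) (at_times X J \<omega>)
    = (\<Prod>t\<in>K. indicator (A t) (X t \<omega>) :: ennreal)"
proof -
  have "at_times X J \<omega> \<in> prod_emb J (\<lambda>_. borel) K (PiE K A) \<longleftrightarrow> (\<forall>t\<in>K. X t \<omega> \<in> A t)"
    using assms by (auto simp: prod_emb_iff restrict_at_times PiE_iff) (auto simp: at_times_def)
  then show ?thesis
    using assms(1) by (auto simp: indicator_def prod_eq_1_iff intro: prod_zero)
qed

lemma at_times_measurable_sigma_gen: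
  "at_times X J \<in> sigma_gen \<Omega> X J \<rightarrow>\<^sub>M PiM J (\<lambda>_. borel)"
  unfolding sigma_gen_def
  by (rule measurable_vimage_algebra1) (auto simp: space_PiM PiE_def)

lemma component_measurable_sigma_gen:
  assumes "t \<in> J"
  shows "X t \<in> borel_measurable (sigma_gen \<Omega> X J)"
proof -
  have "(\<lambda>\<omega>. at_times X J \<omega> t) \<in> borel_measurable (sigma_gen \<Omega> X J)"
    using measurable_compose[OF at_times_measurable_sigma_gen measurable_component_singleton[OF assms]] .
  then show ?thesis
    using assms by (simp add: at_times_def)
qed

lemma at_times_measurable:
  assumes "\<And>t. t \<in> J \<Longrightarrow> X t \<in> borel_measurable A"
  shows "at_times X J \<in> A \<rightarrow>\<^sub>M PiM J (\<lambda>_. borel)"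
  unfolding at_times_def[abs_def] using assms by (rule measurable_restrict)

lemma sets_sigma_gen:
  "sets (sigma_gen \<Omega> X J) = {at_times X J -` A \<inter> space \<Omega> | A. A \<in> sets (PiM J (\<lambda>_. borel))}"
  unfolding sigma_gen_def by (rule sets_vimage_algebra2) (auto simp: space_PiM PiE_def)

lemma subalgebra_sigma_gen:
  assumes "\<And>t. t \<in> J \<Longrightarrow> X t \<in> borel_measurable \<Omega>"
  shows "subalgebra \<Omega> (sigma_gen \<Omega> X J)"
  unfolding subalgebra_def
  using at_times_measurable[OF assms] by (auto simp: sets_sigma_gen intro: measurable_sets)

lemma (in prob_space) sigma_finite_subalgebra_sigma_gen:
  assumes "\<And>t. t \<in> J \<Longrightarrow> X t \<in> borel_measurable M"
  shows "sigma_finite_subalgebra M (sigma_gen M X J)"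
  by (intro finite_measure_subalgebra_is_sigma_finite finite_measure_subalgebra.intro
      finite_measure_subalgebra_axioms.intro subalgebra_sigma_gen assms finite_measure_axioms) 

text \<open>\<open>real_cond_exp\<close> is built from the positive and the negative part. For an
  indicator the first has conditional expectation at most 1 and the second is 0, so
  \<open>enn2real\<close> loses nothing. This links real conditional probabilities with nonnegative
  integrals.\<close>

lemma (in prob_space) nn_cond_exp_indicator:
  assumes "sigma_finite_subalgebra M F" and [measurable]: "A \<in> sets M"
  shows "AE \<omega> in M. nn_cond_exp M F (indicator A) \<omega> = ennreal (real_cond_exp M F (indicator A) \<omega>)"
proof -
  interpret F: sigma_finite_subalgebra M F by fact
  have "AE \<omega> in M. nn_cond_exp M F (indicator A) \<omega> \<le> nn_cond_exp M F (\<lambda>_. 1) \<omega>"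
    by (intro F.nn_cond_exp_mono) (auto simp: indicator_def)
  moreover have "AE \<omega> in M. (1::ennreal) = nn_cond_exp M F (\<lambda>_. 1) \<omega>"
    using F.nn_cond_exp_F_meas[of "\<lambda>_. 1"] by (auto elim: AE_mp)
  moreover have "AE \<omega> in M. (0::ennreal) = nn_cond_exp M F (\<lambda>_. 0) \<omega>"
    using F.nn_cond_exp_F_meas[of "\<lambda>_. 0"] by (auto elim: AE_mp)
  ultimately show ?thesis
  proof eventually_elim
    case (elim \<omega>)
    have "nn_cond_exp M F (indicator A) \<omega> \<noteq> \<top>"
      using elim by (auto simp: top_unique)
    moreover have "(\<lambda>x. ennreal (- indicator A x)) = (\<lambda>_. 0)"
      by (auto simp: ennreal_neg)
    ultimately show ?case
      using elim(3) by (simp add: real_cond_exp_def ennreal_indicator less_top)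
  qed
qed

section \<open>Markov processes with transition densities\<close>

locale bridge_setting =
  fixes T :: "real set"
    and \<Omega> :: "'a measure"
    and Z :: "real \<Rightarrow> 'a \<Rightarrow> real"
    and \<pi> :: "real \<Rightarrow> real measure"
    and M :: "real \<Rightarrow> real set"
    and P :: "real \<Rightarrow> real \<Rightarrow> real \<Rightarrow> real measure"
    and p :: "real \<Rightarrow> real \<Rightarrow> real \<Rightarrow> real \<Rightarrow> ennreal"
    and r v zr zv :: real
  assumes interval: "is_interval T"
    and process: "real_process \<Omega> T Z"
    and law: "\<And>t. t \<in> T \<Longrightarrow> \<pi> t = distr \<Omega> borel (Z t)"
    and M_borel: "\<And>t. t \<in> T \<Longrightarrow> M t \<in> sets borel"
    and M_full: "\<And>t. t \<in> T \<Longrightarrow> emeasure (\<pi> t) (M t) = 1"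
    and transition: "transition_probabilities \<Omega> T Z M P"
    and density_measurable: "\<And>s t. s \<in> T \<Longrightarrow> t \<in> T \<Longrightarrow> s < t \<Longrightarrow>
          (\<lambda>(x, y). p s x t y)
            \<in> borel_measurable (restrict_space borel (M s) \<Otimes>\<^sub>M restrict_space borel (M t))"
    and density_finite: "\<And>s t x y. s \<in> T \<Longrightarrow> t \<in> T \<Longrightarrow> s < t \<Longrightarrow> x \<in> M s \<Longrightarrow> y \<in> M t \<Longrightarrow>
          p s x t y < \<infinity>"
    and density: "\<And>s t x. s \<in> T \<Longrightarrow> t \<in> T \<Longrightarrow> s < t \<Longrightarrow> x \<in> M s \<Longrightarrow>
          P s t x = density (\<pi> t) (\<lambda>y. p s x t y * indicator (M t) y)"
    and rv: "r \<in> T" "v \<in> T" "r < v" and zr: "zr \<in> M r" and zv: "zv \<in> M v"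
    and chapman_kolmogorov: "\<And>s t x. r \<le> s \<Longrightarrow> s < t \<Longrightarrow> t < v \<Longrightarrow> x \<in> M s \<Longrightarrow>
          p s x v zv = (\<integral>\<^sup>+y\<in>M t. (p s x t y * p t y v zv) \<partial>\<pi> t)"
    and endpoint_pos: "0 < p r zr v zv"
begin

sublocale prob_space \<Omega>
  using process by (simp add: real_process_def)

lemma Z_measurable [measurable (raw)]: "t \<in> T \<Longrightarrow> Z t \<in> borel_measurable \<Omega>"
  using process by (simp add: real_process_def)

lemma in_T: "r \<le> t \<Longrightarrow> t \<le> v \<Longrightarrow> t \<in> T"
  using interval rv unfolding is_interval_1 by blast

lemma sets_\<pi> [measurable_cong, simp]: "t \<in> T \<Longrightarrow> sets (\<pi> t) = sets borel"
  by (simp add: law)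

lemma space_\<pi> [simp]: "t \<in> T \<Longrightarrow> space (\<pi> t) = UNIV"
  by (simp add: law)

lemma prob_space_\<pi>: "t \<in> T \<Longrightarrow> prob_space (\<pi> t)"
  using Z_measurable by (simp add: law prob_space_distr)

lemma nn_integral_\<pi>:
  assumes "t \<in> T" "F \<in> borel_measurable borel"
  shows "(\<integral>\<^sup>+y. F y \<partial>\<pi> t) = (\<integral>\<^sup>+\<omega>. F (Z t \<omega>) \<partial>\<Omega>)"
  using assms Z_measurable by (simp add: law nn_integral_distr)

lemma AE_Z_in_M: "t \<in> T \<Longrightarrow> AE \<omega> in \<Omega>. Z t \<omega> \<in> M t"
proof -
  assume t: "t \<in> T"
  interpret \<pi>: prob_space "\<pi> t" by (rule prob_space_\<pi>[OF t])
  have "AE x in \<pi> t. x \<in> M t"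
    using M_full[OF t] M_borel[OF t] t by (intro \<pi>.AE_prob_1) (simp_all add: \<pi>.emeasure_eq_measure)
  then show ?thesis
    unfolding law[OF t] by (rule AE_distrD[OF Z_measurable[OF t]])
qed

section \<open>Transition densities as kernels\<close>

text \<open>Extension of \<open>p\<close> by zero off \<open>M s \<times> M t\<close>: for
  \<open>s < t\<close> in \<open>T\<close> a finite Borel function on the whole plane, free of
  membership conditions.\<close>

definition q :: "real \<Rightarrow> real \<Rightarrow> real \<Rightarrow> real \<Rightarrow> ennreal" where
  "q s x t y = p s x t y * indicator (M s) x * indicator (M t) y"

lemma q_measurable:
  assumes "s \<in> T" "t \<in> T" "s < t"
  shows "(\<lambda>(x, y). q s x t y) \<in> borel_measurable (borel \<Otimes>\<^sub>M borel)"
proof -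
  let ?A = "{z. fst z \<in> M s \<and> snd z \<in> M t} :: (real \<times> real) set"
  have [measurable]: "M s \<in> sets borel" "M t \<in> sets borel"
    using assms M_borel by auto
  \<comment> \<open>Measurability of \<open>p\<close> is given on a product of restricted spaces;
    the identity carries it to the Borel rectangle, from where it extends by zero.\<close>
  have "(\<lambda>z. z) \<in> restrict_space (borel \<Otimes>\<^sub>M borel) ?A
      \<rightarrow>\<^sub>M restrict_space borel (M s) \<Otimes>\<^sub>M restrict_space borel (M t)"
    by (intro measurable_pair measurable_restrict_space2)
       (auto simp: comp_def space_restrict_space intro!: measurable_restrict_space1)
  from measurable_compose[OF this density_measurable[OF assms]]
  have "(\<lambda>(x, y). p s x t y) \<in> borel_measurable (restrict_space (borel \<Otimes>\<^sub>M borel) ?A)"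
    by simp
  moreover have "{z \<in> space (borel \<Otimes>\<^sub>M borel). fst z \<in> M s \<and> snd z \<in> M t} \<in> sets (borel \<Otimes>\<^sub>M borel)"
    by measurable
  ultimately have "(\<lambda>z. if fst z \<in> M s \<and> snd z \<in> M t then case z of (x, y) \<Rightarrow> p s x t y else 0)
      \<in> borel_measurable (borel \<Otimes>\<^sub>M borel)"
    by (subst measurable_If_restrict_space_iff) auto
  also have "(\<lambda>z. if fst z \<in> M s \<and> snd z \<in> M t then case z of (x, y) \<Rightarrow> p s x t y else 0)
      = (\<lambda>(x, y). q s x t y)"
    by (auto simp: q_def fun_eq_iff)
  finally show ?thesis .
qed

lemma q_measurable' [measurable (raw)]:
  assumes "s \<in> T" "t \<in> T" "s < t" "f \<in> borel_measurable N" "g \<in> borel_measurable N"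
  shows "(\<lambda>\<omega>. q s (f \<omega>) t (g \<omega>)) \<in> borel_measurable N"
  using measurable_compose[OF measurable_Pair[OF assms(4,5)] q_measurable[OF assms(1-3)]] by simp

lemma q_finite: "s \<in> T \<Longrightarrow> t \<in> T \<Longrightarrow> s < t \<Longrightarrow> q s x t y < \<top>"
  using density_finite[of s t x y] by (auto simp: q_def indicator_def)

text \<open>The transition operator \<open>F \<mapsto> E(F(Z t) | Z s = x)\<close>, written with
  \<open>q\<close> instead of \<open>P\<close> so that it has the value 0 off
  \<open>M s\<close>.\<close>

definition kernel :: "real \<Rightarrow> real \<Rightarrow> (real \<Rightarrow> ennreal) \<Rightarrow> real \<Rightarrow> ennreal" where
  "kernel s t F x = (\<integral>\<^sup>+y. q s x t y * F y \<partial>\<pi> t)"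

lemma kernel_measurable [measurable (raw)]:
  assumes [simp]: "s \<in> T" "t \<in> T" "s < t" and [measurable]: "F \<in> borel_measurable borel"
    and f: "f \<in> borel_measurable N"
  shows "(\<lambda>\<omega>. kernel s t F (f \<omega>)) \<in> borel_measurable N"
proof -
  interpret \<pi>: prob_space "\<pi> t" by (simp add: prob_space_\<pi>)
  have "(\<lambda>x. kernel s t F x) \<in> borel_measurable borel"
    unfolding kernel_def
    by (rule \<pi>.borel_measurable_nn_integral) (auto simp: case_prod_beta)
  from measurable_compose[OF f this] show ?thesis .
qed

lemma kernel_eq:
  assumes "s \<in> T" "t \<in> T" "s < t" "x \<in> M s" "F \<in> borel_measurable borel"
  shows "kernel s t F x = (\<integral>\<^sup>+y. F y \<partial>P s t x)"
proof -
  have *: "(\<lambda>y. p s x t y * indicator (M t) y) = (\<lambda>y. q s x t y)"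
    using assms by (auto simp: q_def fun_eq_iff)
  have "(\<lambda>y. q s x t y) \<in> borel_measurable borel"
    using assms by measurable
  then show ?thesis
    using assms by (simp add: density * kernel_def nn_integral_density law)
qed

lemma prob_space_P:
  assumes "s \<in> T" "t \<in> T" "s < t" "x \<in> M s"
  shows "prob_space (P s t x)"
proof -
  have "P s t \<in> restrict_space borel (M s) \<rightarrow>\<^sub>M prob_algebra borel"
    using transition assms by (auto simp: transition_probabilities_def)
  then have "P s t x \<in> space (prob_algebra borel)"
    using assms by (auto simp: space_restrict_space dest: measurable_space)
  then show ?thesis
    by (simp add: space_prob_algebra)
qed

section \<open>The Markov property as an integral identity\<close>

text \<open>\<open>W\<close> depends only on the past of \<open>s\<close>, so the indicator may be
  replaced by its conditional expectation given that past, which \<open>transition\<close>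
  identifies with the kernel at \<open>Z s\<close>.\<close>

lemma markov_step_indicator:
  assumes st: "s \<in> T" "t \<in> T" "s < t"
    and W: "W \<in> borel_measurable (sigma_gen \<Omega> Z {u \<in> T. u \<le> s})"
    and B [measurable]: "B \<in> sets borel"
  shows "(\<integral>\<^sup>+\<omega>. W \<omega> * indicator B (Z t \<omega>) \<partial>\<Omega>) = (\<integral>\<^sup>+\<omega>. W \<omega> * kernel s t (indicator B) (Z s \<omega>) \<partial>\<Omega>)"
proof -
  let ?G = "sigma_gen \<Omega> Z {u \<in> T. u \<le> s}"
  interpret G: sigma_finite_subalgebra \<Omega> ?G
    by (rule sigma_finite_subalgebra_sigma_gen) (auto intro: Z_measurable)
  have [measurable]: "Z t \<in> borel_measurable \<Omega>" using st by (simp add: Z_measurable)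
  define A where "A = Z t -` B \<inter> space \<Omega>"
  have [measurable]: "A \<in> sets \<Omega>" unfolding A_def by measurable
  have ind: "indicator A \<omega> = indicator B (Z t \<omega>)" if "\<omega> \<in> space \<Omega>" for \<omega>
    using that by (auto simp: A_def indicator_def)
  have "AE \<omega> in \<Omega>. real_cond_exp \<Omega> ?G (\<lambda>\<omega>. indicator B (Z t \<omega>)) \<omega> = measure (P s t (Z s \<omega>)) B"
    using transition st B by (auto simp: transition_probabilities_def)
  moreover have "AE \<omega> in \<Omega>. real_cond_exp \<Omega> ?G (\<lambda>\<omega>. indicator B (Z t \<omega>)) \<omega>
      = real_cond_exp \<Omega> ?G (indicator A) \<omega>"
    by (rule G.real_cond_exp_cong) (auto simp: A_def indicator_def)
  moreover have "AE \<omega> in \<Omega>. nn_cond_exp \<Omega> ?G (indicator A) \<omega> = ennreal (real_cond_exp \<Omega> ?G (indicator A) \<omega>)"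
    by (rule nn_cond_exp_indicator) (unfold_locales, simp)
  \<comment> \<open>The kernel is tied to \<open>P s t x\<close> only for \<open>x\<close> in
    \<open>M s\<close>, hence the appeal to \<open>AE_Z_in_M\<close>.\<close>
  ultimately have AE: "AE \<omega> in \<Omega>. nn_cond_exp \<Omega> ?G (indicator A) \<omega> = kernel s t (indicator B) (Z s \<omega>)"
    using AE_Z_in_M[OF st(1)]
  proof eventually_elim
    case (elim \<omega>)
    interpret Pst: prob_space "P s t (Z s \<omega>)"
      using st elim(4) by (rule prob_space_P)
    have "sets (P s t (Z s \<omega>)) = sets borel"
      using st elim(4) by (simp add: density)
    then show ?case
      using elim st by (simp add: kernel_eq Pst.emeasure_eq_measure)
  qed
  have "(\<integral>\<^sup>+\<omega>. W \<omega> * indicator B (Z t \<omega>) \<partial>\<Omega>) = (\<integral>\<^sup>+\<omega>. W \<omega> * indicator A \<omega> \<partial>\<Omega>)"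
    by (intro nn_integral_cong) (simp add: ind)
  also have "\<dots> = (\<integral>\<^sup>+\<omega>. W \<omega> * nn_cond_exp \<Omega> ?G (indicator A) \<omega> \<partial>\<Omega>)"
    by (rule G.nn_cond_exp_intg[symmetric]) (use W in auto)
  also have "\<dots> = (\<integral>\<^sup>+\<omega>. W \<omega> * kernel s t (indicator B) (Z s \<omega>) \<partial>\<Omega>)"
    by (rule nn_integral_cong_AE) (use AE in auto)
  finally show ?thesis .
qed

text \<open>Both sides integrate \<open>F\<close> against a measure: the image under
  \<open>Z t\<close> of \<open>\<Omega>\<close> with density \<open>W\<close>, and
  \<open>\<pi> t\<close> with density \<open>D\<close>. Agreement on indicators makes the measures
  equal, so all \<open>F\<close> follow at once.\<close>

lemma markov_step:
  assumes st [simp]: "s \<in> T" "t \<in> T" "s < t"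
    and W: "W \<in> borel_measurable (sigma_gen \<Omega> Z {u \<in> T. u \<le> s})"
    and [measurable]: "F \<in> borel_measurable borel"
  shows "(\<integral>\<^sup>+\<omega>. W \<omega> * F (Z t \<omega>) \<partial>\<Omega>) = (\<integral>\<^sup>+\<omega>. W \<omega> * kernel s t F (Z s \<omega>) \<partial>\<Omega>)"
proof -
  interpret \<pi>: prob_space "\<pi> t" by (simp add: prob_space_\<pi>)
  interpret pair_sigma_finite \<Omega> "\<pi> t" ..
  have [measurable]: "W \<in> borel_measurable \<Omega>"
    by (rule measurable_from_subalg[OF subalgebra_sigma_gen W]) (auto intro: Z_measurable)
  have [measurable]: "Z s \<in> borel_measurable \<Omega>" "Z t \<in> borel_measurable \<Omega>"
    by (simp_all add: Z_measurable)
  \<comment> \<open>The transition density into \<open>y\<close>, averaged over the present state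
    with weight \<open>W\<close>.\<close>
  define D where "D y = (\<integral>\<^sup>+\<omega>. W \<omega> * q s (Z s \<omega>) t y \<partial>\<Omega>)" for y
  have [measurable]: "(\<lambda>(\<omega>, y). W \<omega> * q s (Z s \<omega>) t y) \<in> borel_measurable (\<Omega> \<Otimes>\<^sub>M \<pi> t)"
    by (simp add: case_prod_beta)
  have [measurable]: "D \<in> borel_measurable (\<pi> t)"
    unfolding D_def by measurable
  have fubini: "(\<integral>\<^sup>+\<omega>. W \<omega> * kernel s t G (Z s \<omega>) \<partial>\<Omega>) = (\<integral>\<^sup>+y. D y * G y \<partial>\<pi> t)"
    if [measurable]: "G \<in> borel_measurable borel" for G
  proof -
    have "(\<integral>\<^sup>+\<omega>. W \<omega> * kernel s t G (Z s \<omega>) \<partial>\<Omega>) = (\<integral>\<^sup>+\<omega>. (\<integral>\<^sup>+y. (W \<omega> * q s (Z s \<omega>) t y) * G y \<partial>\<pi> t) \<partial>\<Omega>)"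
      by (simp add: kernel_def nn_integral_cmult[symmetric] mult.assoc)
    also have "\<dots> = (\<integral>\<^sup>+y. (\<integral>\<^sup>+\<omega>. (W \<omega> * q s (Z s \<omega>) t y) * G y \<partial>\<Omega>) \<partial>\<pi> t)"
      by (rule Fubini'[symmetric]) (simp add: case_prod_beta)
    also have "\<dots> = (\<integral>\<^sup>+y. D y * G y \<partial>\<pi> t)"
      by (simp add: D_def nn_integral_multc)
    finally show ?thesis .
  qed
  have "distr (density \<Omega> W) borel (Z t) = density (\<pi> t) D"
  proof (rule measure_eqI)
    fix B assume "B \<in> sets (distr (density \<Omega> W) borel (Z t))"
    then have [measurable]: "B \<in> sets borel" by simp
    have "emeasure (distr (density \<Omega> W) borel (Z t)) B = (\<integral>\<^sup>+\<omega>. W \<omega> * indicator B (Z t \<omega>) \<partial>\<Omega>)"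
      by (simp add: emeasure_distr emeasure_density)
         (intro nn_integral_cong, auto simp: indicator_def)
    also have "\<dots> = emeasure (density (\<pi> t) D) B"
      using markov_step_indicator[OF st W, of B] by (simp add: fubini emeasure_density)
    finally show "emeasure (distr (density \<Omega> W) borel (Z t)) B = emeasure (density (\<pi> t) D) B" .
  qed simp
  then have "(\<integral>\<^sup>+y. F y \<partial>distr (density \<Omega> W) borel (Z t)) = (\<integral>\<^sup>+y. F y \<partial>density (\<pi> t) D)"
    by simp
  then show ?thesis
    by (simp add: nn_integral_distr nn_integral_density fubini)
qed

text \<open>As in \<open>markov_step\<close>, two measures with densities relative to
  \<open>\<pi> u\<close> are compared on Borel sets, where the claim is Chapman-Kolmogorov for
  \<open>P\<close>. That equation holds from every \<open>x\<close> in \<open>M s\<close>, so the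
  result is pointwise in \<open>x\<close>.\<close>

lemma kernel_kernel:
  assumes T [simp]: "s \<in> T" "t \<in> T" "u \<in> T" and st [simp]: "s < t" "t < u"
    and x: "x \<in> M s" and [measurable]: "F \<in> borel_measurable borel"
  shows "kernel s t (kernel t u F) x = kernel s u F x"
proof -
  have [simp]: "s < u" by (rule less_trans[OF st])
  interpret \<pi>t: prob_space "\<pi> t" by (simp add: prob_space_\<pi>)
  interpret \<pi>u: prob_space "\<pi> u" by (simp add: prob_space_\<pi>)
  interpret pair_sigma_finite "\<pi> t" "\<pi> u" ..
  define D where "D z = (\<integral>\<^sup>+y. q s x t y * q t y u z \<partial>\<pi> t)" for z
  have [measurable]: "(\<lambda>(y, z). q s x t y * q t y u z) \<in> borel_measurable (\<pi> t \<Otimes>\<^sub>M \<pi> u)"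
    by (simp add: case_prod_beta)
  have [measurable]: "D \<in> borel_measurable (\<pi> u)"
    unfolding D_def by measurable
  have fubini: "kernel s t (kernel t u G) x = (\<integral>\<^sup>+z. D z * G z \<partial>\<pi> u)"
    if [measurable]: "G \<in> borel_measurable borel" for G
  proof -
    have "kernel s t (kernel t u G) x = (\<integral>\<^sup>+y. (\<integral>\<^sup>+z. (q s x t y * q t y u z) * G z \<partial>\<pi> u) \<partial>\<pi> t)"
      by (simp add: kernel_def nn_integral_cmult[symmetric] mult.assoc)
    also have "\<dots> = (\<integral>\<^sup>+z. (\<integral>\<^sup>+y. (q s x t y * q t y u z) * G z \<partial>\<pi> t) \<partial>\<pi> u)"
      by (rule Fubini'[symmetric]) (simp add: case_prod_beta)
    also have "\<dots> = (\<integral>\<^sup>+z. D z * G z \<partial>\<pi> u)"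
      by (simp add: D_def nn_integral_multc)
    finally show ?thesis .
  qed
  have "density (\<pi> u) D = density (\<pi> u) (q s x u)"
  proof (rule measure_eqI)
    fix B assume "B \<in> sets (density (\<pi> u) D)"
    then have B [measurable]: "B \<in> sets borel" by simp
    have "emeasure (density (\<pi> u) D) B = kernel s t (kernel t u (indicator B)) x"
      by (simp add: fubini emeasure_density)
    also have "\<dots> = (\<integral>\<^sup>+y. kernel t u (indicator B) y \<partial>P s t x)"
      using x by (intro kernel_eq) auto
    \<comment> \<open>The factor \<open>indicator (M t)\<close> inside \<open>q\<close> reproduces
      the restriction to \<open>M t\<close> in the equation for \<open>P\<close>.\<close>
    also have "\<dots> = (\<integral>\<^sup>+y\<in>M t. emeasure (P t u y) B \<partial>P s t x)"
    proof (rule nn_integral_cong)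
      fix y
      show "kernel t u (indicator B) y = emeasure (P t u y) B * indicator (M t) y"
      proof (cases "y \<in> M t")
        case True
        then have "sets (P t u y) = sets borel"
          by (simp add: density)
        with True show ?thesis
          by (simp add: kernel_eq)
      qed (simp add: kernel_def q_def)
    qed
    also have "\<dots> = emeasure (P s u x) B"
    proof -
      have "\<forall>x\<in>M s. \<forall>B\<in>sets borel. emeasure (P s u x) B = (\<integral>\<^sup>+y\<in>M t. emeasure (P t u y) B \<partial>P s t x)"
        using transition T st unfolding transition_probabilities_def by blast
      with x B show ?thesis by simp
    qed
    also have "\<dots> = emeasure (density (\<pi> u) (q s x u)) B"
    proof -
      have "sets (P s u x) = sets borel"
        using x by (simp add: density)
      then have "emeasure (P s u x) B = kernel s u (indicator B) x"
        using x by (simp add: kernel_eq)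
      then show ?thesis
        by (simp add: kernel_def emeasure_density)
    qed
    finally show "emeasure (density (\<pi> u) D) B = emeasure (density (\<pi> u) (q s x u)) B" .
  qed simp
  then have "(\<integral>\<^sup>+z. F z \<partial>density (\<pi> u) D) = (\<integral>\<^sup>+z. F z \<partial>density (\<pi> u) (q s x u))"
    by simp
  then have "kernel s t (kernel t u F) x = (\<integral>\<^sup>+z. q s x u z * F z \<partial>\<pi> u)"
    by (simp add: fubini nn_integral_density)
  then show ?thesis
    by (simp only: kernel_def[of s u])
qed

text \<open>Space-time harmonicity of the function \<open>q t y v zv\<close> that drives the
  \<open>h\<close>-transform. It concerns the density at the single point \<open>zv\<close>, which
  may be \<open>\<pi> v\<close>-null, so it comes from \<open>chapman_kolmogorov\<close> and not
  from \<open>P\<close>.\<close>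

lemma kernel_endpoint:
  assumes "r \<le> s" "s < t" "t < v"
  shows "kernel s t (\<lambda>y. q t y v zv) x = q s x v zv"
proof (cases "x \<in> M s")
  case True
  then have "q s x v zv = (\<integral>\<^sup>+y\<in>M t. (p s x t y * p t y v zv) \<partial>\<pi> t)"
    using chapman_kolmogorov[OF assms] zv by (simp add: q_def)
  also have "\<dots> = kernel s t (\<lambda>y. q t y v zv) x"
    unfolding kernel_def using True zv by (intro nn_integral_cong) (auto simp: q_def indicator_def)
  finally show ?thesis by simp
qed (simp add: kernel_def q_def)

lemma sigma_gen_past_measurable [measurable (raw)]:
  "t \<in> T \<Longrightarrow> t \<le> s \<Longrightarrow> Z t \<in> borel_measurable (sigma_gen \<Omega> Z {u \<in> T. u \<le> s})"
  by (rule component_measurable_sigma_gen) simp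

section \<open>Integrating out times\<close>

text \<open>Conditioning on the past of \<open>Max K\<close> turns the factor at the last time
  \<open>b\<close> into a kernel at \<open>Max K\<close>, absorbed into the factor there. The
  product form survives, so the step can be repeated.\<close>

lemma prod_drop_last:
  assumes K: "finite K" "K \<noteq> {}" "K \<subseteq> T" and b: "b \<in> T" "Max K < b"
    and W: "W \<in> borel_measurable (sigma_gen \<Omega> Z {u \<in> T. u \<le> Max K})"
    and F [measurable]: "\<And>t. F t \<in> borel_measurable borel"
  shows "(\<integral>\<^sup>+\<omega>. W \<omega> * (\<Prod>t\<in>insert b K. F t (Z t \<omega>)) \<partial>\<Omega>)
    = (\<integral>\<^sup>+\<omega>. W \<omega> * (\<Prod>t\<in>K. (F(Max K := \<lambda>x. F (Max K) x * kernel (Max K) b (F b) x)) t (Z t \<omega>)) \<partial>\<Omega>)"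
proof -
  let ?c = "Max K"
  let ?G = "F(?c := \<lambda>x. F ?c x * kernel ?c b (F b) x)"
  have c: "?c \<in> K" "?c \<in> T" using K Max_in by auto
  have bK: "b \<notin> K" using K b by (auto simp: not_less[symmetric])
  have [measurable]: "Z t \<in> borel_measurable (sigma_gen \<Omega> Z {u \<in> T. u \<le> ?c})" if "t \<in> K" for t
    using that K by (intro sigma_gen_past_measurable) auto
  have prod_G: "(\<Prod>t\<in>K. ?G t (Z t \<omega>)) = (\<Prod>t\<in>K. F t (Z t \<omega>)) * kernel ?c b (F b) (Z ?c \<omega>)" for \<omega>
    using K c by (simp add: prod.remove[of K ?c] mult_ac)
  have "(\<integral>\<^sup>+\<omega>. W \<omega> * (\<Prod>t\<in>insert b K. F t (Z t \<omega>)) \<partial>\<Omega>)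
      = (\<integral>\<^sup>+\<omega>. (W \<omega> * (\<Prod>t\<in>K. F t (Z t \<omega>))) * F b (Z b \<omega>) \<partial>\<Omega>)"
    using K bK by (simp add: mult_ac)
  also have "\<dots> = (\<integral>\<^sup>+\<omega>. (W \<omega> * (\<Prod>t\<in>K. F t (Z t \<omega>))) * kernel ?c b (F b) (Z ?c \<omega>) \<partial>\<Omega>)"
    using c b W F
    by (intro markov_step)
       (auto intro!: borel_measurable_times_ennreal borel_measurable_prod_ennreal measurable_compose[OF _ F])
  finally show ?thesis
    by (simp only: prod_G mult.assoc)
qed

text \<open>
  Shifting the entrance time is a statement about the future given \<open>Z a\<close>: the factors are integrated
  out one by one, latest time first, until only the Chapman-Kolmogorov equation at \<open>(r, zr)\<close> is left.
\<close>

lemma entrance_shift: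
  assumes "r < a" "a < a'" "a' \<le> v"
    and "finite J" "J \<subseteq> {a'<..v}"
    and "\<And>t. F t \<in> borel_measurable borel"
  shows "(\<integral>\<^sup>+\<omega>. q r zr a (Z a \<omega>) * (\<Prod>t\<in>insert a' J. F t (Z t \<omega>)) \<partial>\<Omega>)
    = (\<integral>\<^sup>+\<omega>. q r zr a' (Z a' \<omega>) * (\<Prod>t\<in>insert a' J. F t (Z t \<omega>)) \<partial>\<Omega>)"
  using assms(4-)
\<comment> \<open>The largest time is peeled off; \<open>F\<close> is generalised because each
  peeling changes the factor at the new last time.\<close>
proof (induction J arbitrary: F rule: finite_linorder_max_induct)
  case empty
  note [measurable] = empty(2)
  have [simp]: "a \<in> T" "a' \<in> T" "r \<in> T" "r < a" "r < a'" "a < a'"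
    using assms in_T rv by auto
  have "(\<integral>\<^sup>+\<omega>. q r zr a (Z a \<omega>) * F a' (Z a' \<omega>) \<partial>\<Omega>)
      = (\<integral>\<^sup>+\<omega>. q r zr a (Z a \<omega>) * kernel a a' (F a') (Z a \<omega>) \<partial>\<Omega>)"
    by (rule markov_step) auto
  \<comment> \<open>Weighted by \<open>q r zr a\<close>, the law of \<open>Z a\<close> becomes the
    transition law from \<open>zr\<close> at time \<open>r\<close>, so the two steps compose by
    \<open>kernel_kernel\<close>.\<close>
  also have "\<dots> = kernel r a (kernel a a' (F a')) zr"
    unfolding kernel_def[of r a] by (rule nn_integral_\<pi>[symmetric]) auto
  also have "\<dots> = kernel r a' (F a') zr"
    by (rule kernel_kernel) (auto simp: zr)
  also have "\<dots> = (\<integral>\<^sup>+\<omega>. q r zr a' (Z a' \<omega>) * F a' (Z a' \<omega>) \<partial>\<Omega>)"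
    unfolding kernel_def by (rule nn_integral_\<pi>) auto
  finally show ?case by simp
next
  case (insert b J)
  note [measurable] = insert.prems(2)
  let ?K = "insert a' J"
  let ?G = "F(Max ?K := \<lambda>x. F (Max ?K) x * kernel (Max ?K) b (F b) x)"
  have T [simp]: "a \<in> T" "a' \<in> T" "r \<in> T" "r < a" "r < a'" "a < a'"
    using assms in_T rv by auto
  have J: "insert b J \<subseteq> {a'<..v}" by fact
  have "t \<in> T" if "t \<in> insert b J" for t
  proof (rule in_T)
    show "r \<le> t" "t \<le> v"
      using subsetD[OF J that] order.strict_trans[OF order.strict_trans[OF assms(1,2)], of t] by (auto intro: less_imp_le)
  qed
  then have KT: "?K \<subseteq> T" and b: "b \<in> T" "Max ?K < b"
    using insert.prems insert.hyps by auto
  have Max: "Max ?K \<in> T"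
    using KT Max_in[of ?K] insert.hyps by blast
  \<comment> \<open>Hence both entrance weights, at \<open>a\<close> and at \<open>a'\<close>, are
    measurable in the past of \<open>Max ?K\<close> and can serve as \<open>W\<close> in
    \<open>prod_drop_last\<close>.\<close>
  have "a' \<le> Max ?K"
    using insert.hyps by simp
  then have "a \<le> Max ?K"
    by (rule order.trans[OF less_imp_le[OF assms(2)]])
  have G: "?G t \<in> borel_measurable borel" for t
    using Max b by auto
  have drop: "(\<integral>\<^sup>+\<omega>. q r zr c (Z c \<omega>) * (\<Prod>t\<in>insert b ?K. F t (Z t \<omega>)) \<partial>\<Omega>)
      = (\<integral>\<^sup>+\<omega>. q r zr c (Z c \<omega>) * (\<Prod>t\<in>?K. ?G t (Z t \<omega>)) \<partial>\<Omega>)" if "c \<in> {a, a'}" for c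
    using insert.hyps KT b that \<open>a \<le> Max ?K\<close> \<open>a' \<le> Max ?K\<close> by (intro prod_drop_last) auto
  have IH: "(\<integral>\<^sup>+\<omega>. q r zr a (Z a \<omega>) * (\<Prod>t\<in>?K. ?G t (Z t \<omega>)) \<partial>\<Omega>)
      = (\<integral>\<^sup>+\<omega>. q r zr a' (Z a' \<omega>) * (\<Prod>t\<in>?K. ?G t (Z t \<omega>)) \<partial>\<Omega>)"
    by (rule insert.IH[OF _ G]) (use insert.prems in simp)
  show ?case
    unfolding insert_commute[of a' b] drop[OF insertI1] drop[OF insertI2[OF insertI1]] by (rule IH)
qed

section \<open>The change of measure\<close>

definition weight :: "real \<Rightarrow> real \<Rightarrow> 'a \<Rightarrow> ennreal" where
  "weight a b \<omega> = q r zr a (Z a \<omega>) * q b (Z b \<omega>) v zv"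

lemma weight_measurable [measurable]:
  "r < a \<Longrightarrow> a \<le> b \<Longrightarrow> b < v \<Longrightarrow> weight a b \<in> borel_measurable \<Omega>"
  unfolding weight_def[abs_def] using in_T rv by (auto intro!: Z_measurable)

text \<open>The ends are moved separately: the right one to \<open>b'\<close> by harmonicity, given
  the past of \<open>b'\<close>; the left one to \<open>a'\<close> by \<open>entrance_shift\<close>,
  with \<open>q b' y v zv\<close> as one more factor of the product.\<close>

lemma weight_shift:
  assumes ab: "r < a" "a \<le> a'" "a' \<le> b'" "b' \<le> b" "b < v"
    and J: "finite J" "J \<subseteq> {a'..b'}"
    and F [measurable]: "\<And>t. F t \<in> borel_measurable borel"
  shows "(\<integral>\<^sup>+\<omega>. weight a b \<omega> * (\<Prod>t\<in>J. F t (Z t \<omega>)) \<partial>\<Omega>)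
    = (\<integral>\<^sup>+\<omega>. weight a' b' \<omega> * (\<Prod>t\<in>J. F t (Z t \<omega>)) \<partial>\<Omega>)"
proof -
  have JT: "J \<subseteq> T" using J ab by (auto simp: subset_eq intro!: in_T)
  have endpoint: "b' < b \<Longrightarrow> kernel b' b (\<lambda>y. q b y v zv) x = q b' x v zv" for x
    using ab by (intro kernel_endpoint) auto
  have T [simp]: "a \<in> T" "a' \<in> T" "b \<in> T" "b' \<in> T" "r \<in> T" "v \<in> T" "r < a" "b < v" "b' < v" "a \<le> b'"
    using ab in_T rv by auto
  let ?\<beta> = "\<lambda>y. q b' y v zv"
  have right: "(\<integral>\<^sup>+\<omega>. weight a b \<omega> * (\<Prod>t\<in>J. F t (Z t \<omega>)) \<partial>\<Omega>)
      = (\<integral>\<^sup>+\<omega>. weight a b' \<omega> * (\<Prod>t\<in>J. F t (Z t \<omega>)) \<partial>\<Omega>)"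
  proof (cases "b' < b")
    case True
    have [measurable]: "Z t \<in> borel_measurable (sigma_gen \<Omega> Z {u \<in> T. u \<le> b'})" if "t \<in> J" for t
      using that JT J by (intro sigma_gen_past_measurable) auto
    have "(\<integral>\<^sup>+\<omega>. weight a b \<omega> * (\<Prod>t\<in>J. F t (Z t \<omega>)) \<partial>\<Omega>)
       = (\<integral>\<^sup>+\<omega>. (q r zr a (Z a \<omega>) * (\<Prod>t\<in>J. F t (Z t \<omega>))) * q b (Z b \<omega>) v zv \<partial>\<Omega>)"
      by (simp add: weight_def mult_ac)
    also have "\<dots> = (\<integral>\<^sup>+\<omega>. (q r zr a (Z a \<omega>) * (\<Prod>t\<in>J. F t (Z t \<omega>)))
        * kernel b' b (\<lambda>y. q b y v zv) (Z b' \<omega>) \<partial>\<Omega>)"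
      using True by (intro markov_step) (auto intro!: borel_measurable_times_ennreal borel_measurable_prod_ennreal)
    also have "\<dots> = (\<integral>\<^sup>+\<omega>. weight a b' \<omega> * (\<Prod>t\<in>J. F t (Z t \<omega>)) \<partial>\<Omega>)"
      using True by (simp add: endpoint weight_def mult_ac)
    finally show ?thesis .
  qed (use ab in simp)
  show ?thesis
  proof (cases "a < a'")
    case True
    \<comment> \<open>Merges \<open>F\<close> with the exit factor at \<open>b'\<close>, which may
      or may not lie in \<open>J\<close>; the neutral value 1 fills the other times.\<close>
    define G where "G t x = (if t \<in> J then F t x else 1) * (if t = b' then ?\<beta> x else 1)" for t x
    have [measurable]: "G t \<in> borel_measurable borel" for t
      unfolding G_def[abs_def] by auto
    \<comment> \<open>Removing \<open>a'\<close> before inserting it again leaves times strictly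
      after \<open>a'\<close>, as \<open>entrance_shift\<close> requires, also when
      \<open>b' = a'\<close>.\<close>
    have prod_G: "(\<Prod>t\<in>insert a' (insert b' J - {a'}). G t (Z t \<omega>)) = (\<Prod>t\<in>J. F t (Z t \<omega>)) * ?\<beta> (Z b' \<omega>)" for \<omega>
    proof -
      let ?K = "insert a' (insert b' J)"
      have "(\<Prod>t\<in>?K. G t (Z t \<omega>)) = (\<Prod>t\<in>?K. if t \<in> J then F t (Z t \<omega>) else 1) * (\<Prod>t\<in>?K. if t = b' then ?\<beta> (Z t \<omega>) else 1)"
        by (simp add: G_def prod.distrib)
      also have "(\<Prod>t\<in>?K. if t \<in> J then F t (Z t \<omega>) else 1) = (\<Prod>t\<in>?K \<inter> J. F t (Z t \<omega>))"
        using J by (intro prod.inter_restrict[symmetric]) auto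
      also have "?K \<inter> J = J" by auto
      also have "(\<Prod>t\<in>?K. if t = b' then ?\<beta> (Z t \<omega>) else 1) = ?\<beta> (Z b' \<omega>)"
        using J by (subst prod.delta) auto
      finally show ?thesis by simp
    qed
    have "(\<integral>\<^sup>+\<omega>. weight a b' \<omega> * (\<Prod>t\<in>J. F t (Z t \<omega>)) \<partial>\<Omega>)
      = (\<integral>\<^sup>+\<omega>. q r zr a (Z a \<omega>) * (\<Prod>t\<in>insert a' (insert b' J - {a'}). G t (Z t \<omega>)) \<partial>\<Omega>)"
      unfolding prod_G weight_def by (simp add: mult_ac)
    also have "\<dots> = (\<integral>\<^sup>+\<omega>. q r zr a' (Z a' \<omega>) * (\<Prod>t\<in>insert a' (insert b' J - {a'}). G t (Z t \<omega>)) \<partial>\<Omega>)"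
      using ab J True by (intro entrance_shift) (auto simp: subset_eq less_le)
    also have "\<dots> = (\<integral>\<^sup>+\<omega>. weight a' b' \<omega> * (\<Prod>t\<in>J. F t (Z t \<omega>)) \<partial>\<Omega>)"
      unfolding prod_G weight_def by (simp add: mult_ac)
    finally show ?thesis using right by simp
  qed (use ab right in simp)
qed

text \<open>The window shrinks to the single time \<open>a\<close>, where one Chapman-Kolmogorov
  step from \<open>(r, zr)\<close> yields the constant.\<close>

lemma weight_total:
  assumes "r < a" "a \<le> b" "b < v"
  shows "(\<integral>\<^sup>+\<omega>. weight a b \<omega> \<partial>\<Omega>) = p r zr v zv"
proof -
  have [simp]: "a \<in> T" "r \<in> T" "v \<in> T" "r < a" "a < v"
    using assms in_T rv by auto
  have "(\<integral>\<^sup>+\<omega>. weight a b \<omega> \<partial>\<Omega>) = (\<integral>\<^sup>+\<omega>. weight a a \<omega> \<partial>\<Omega>)"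
    using weight_shift[of a a a b "{}" "\<lambda>_ _. 0"] assms by simp
  also have "\<dots> = kernel r a (\<lambda>y. q a y v zv) zr"
    unfolding kernel_def weight_def by (rule nn_integral_\<pi>[symmetric]) auto
  also have "\<dots> = q r zr v zv"
    using assms by (intro kernel_endpoint) auto
  also have "\<dots> = p r zr v zv"
    using zr zv by (simp add: q_def)
  finally show ?thesis .
qed

lemma endpoint_finite: "p r zr v zv < \<top>"
  using density_finite rv zr zv by auto

definition tilted :: "real \<Rightarrow> real \<Rightarrow> 'a measure" where
  "tilted a b = density \<Omega> (\<lambda>\<omega>. weight a b \<omega> / p r zr v zv)"

lemma sets_tilted [measurable_cong, simp]: "sets (tilted a b) = sets \<Omega>"
  by (simp add: tilted_def)

lemma nn_integral_tilted:
  assumes "r < a" "a \<le> b" "b < v" and [measurable]: "F \<in> borel_measurable \<Omega>"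
  shows "(\<integral>\<^sup>+\<omega>. F \<omega> \<partial>tilted a b) = (\<integral>\<^sup>+\<omega>. weight a b \<omega> * F \<omega> \<partial>\<Omega>) / p r zr v zv"
proof -
  note [measurable] = weight_measurable[OF assms(1-3)]
  show ?thesis
    by (simp add: tilted_def nn_integral_density nn_integral_divide[symmetric] ennreal_divide_times
        ennreal_times_divide mult.commute)
qed

lemma prob_space_tilted:
  assumes "r < a" "a \<le> b" "b < v"
  shows "prob_space (tilted a b)"
proof
  have "emeasure (tilted a b) (space (tilted a b)) = (\<integral>\<^sup>+\<omega>. 1 \<partial>tilted a b)"
    by simp
  also have "\<dots> = p r zr v zv / p r zr v zv"
    using assms by (subst nn_integral_tilted) (auto simp: weight_total)
  also have "\<dots> = 1"
    using endpoint_pos endpoint_finite by (intro ennreal_divide_self) auto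
  finally show "emeasure (tilted a b) (space (tilted a b)) = 1" .
qed

lemma at_times_Z_measurable:
  assumes "r < a" "b < v" "J \<subseteq> {a..b}"
  shows "at_times Z J \<in> \<Omega> \<rightarrow>\<^sub>M PiM J (\<lambda>_. borel)"
proof (rule at_times_measurable)
  fix t assume "t \<in> J"
  then have "a \<le> t" "t \<le> b" using assms by auto
  then show "Z t \<in> borel_measurable \<Omega>"
    using assms by (intro Z_measurable in_T) auto
qed

section \<open>Finite-dimensional laws and their consistency\<close>

definition path_law :: "real \<Rightarrow> real \<Rightarrow> real set \<Rightarrow> (real \<Rightarrow> real) measure" where
  "path_law a b J = distr (tilted a b) (PiM J (\<lambda>_. borel)) (at_times Z J)"

lemma sets_path_law [simp]: "sets (path_law a b J) = sets (PiM J (\<lambda>_. borel))"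
  by (simp add: path_law_def)

lemma nn_integral_path_law:
  assumes "r < a" "a \<le> b" "b < v" "J \<subseteq> {a..b}"
    and "G \<in> borel_measurable (PiM J (\<lambda>_. borel))"
  shows "(\<integral>\<^sup>+f. G f \<partial>path_law a b J) = (\<integral>\<^sup>+\<omega>. weight a b \<omega> * G (at_times Z J \<omega>) \<partial>\<Omega>) / p r zr v zv"
proof -
  note [measurable] = at_times_Z_measurable[OF assms(1,3,4)] assms(5)
  show ?thesis
    using assms(1-3) by (simp add: path_law_def nn_integral_distr nn_integral_tilted)
qed

lemma prob_space_path_law:
  assumes "r < a" "a \<le> b" "b < v" "J \<subseteq> {a..b}"
  shows "prob_space (path_law a b J)"
  unfolding path_law_def using assms
  by (intro prob_space.prob_space_distr prob_space_tilted)
     (auto intro: at_times_Z_measurable simp: measurable_cong_sets[OF sets_tilted refl])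

text \<open>Finite measures on a product agree once they agree on cylinders, whose indicators are
  products to which \<open>weight_shift\<close> applies.\<close>

lemma path_law_shrink:
  assumes "r < a" "a \<le> a'" "a' \<le> b'" "b' \<le> b" "b < v" and J: "finite J" "J \<subseteq> {a'..b'}"
  shows "path_law a b J = path_law a' b' J"
proof (rule measure_eqI_PiM_infinite)
  have sub: "J \<subseteq> {a..b}" using assms by auto
  show "finite_measure (path_law a b J)"
    using assms sub by (intro prob_space.finite_measure prob_space_path_law) auto
  fix A :: "real \<Rightarrow> real set" and K
  assume K: "finite K" "K \<subseteq> J" and A: "\<And>i. i \<in> K \<Longrightarrow> A i \<in> sets borel"
  let ?E = "prod_emb J (\<lambda>_. borel) K (PiE K A)"
  have E: "?E \<in> sets (PiM J (\<lambda>_. borel))"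
    using K A by (intro sets_PiM_I) auto
  \<comment> \<open>The value 1 off \<open>K\<close> makes \<open>F t\<close> Borel for every
    \<open>t\<close>, as \<open>weight_shift\<close> demands.\<close>
  define F where "F t = (if t \<in> K then indicator (A t) else (\<lambda>_. 1) :: real \<Rightarrow> ennreal)" for t
  have [measurable]: "F t \<in> borel_measurable borel" for t
    using A by (auto simp: F_def)
  have F: "indicator ?E (at_times Z J \<omega>) = (\<Prod>t\<in>K. F t (Z t \<omega>))" for \<omega>
    using K by (simp add: indicator_at_times_emb F_def)
  have emeasure: "emeasure (path_law c d J) ?E = (\<integral>\<^sup>+\<omega>. weight c d \<omega> * (\<Prod>t\<in>K. F t (Z t \<omega>)) \<partial>\<Omega>) / p r zr v zv"
    if "r < c" "c \<le> d" "d < v" "J \<subseteq> {c..d}" for c d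
    using nn_integral_path_law[OF that, of "indicator ?E"] E by (simp add: F)
  show "emeasure (path_law a b J) ?E = emeasure (path_law a' b' J) ?E"
    using assms sub K by (simp add: emeasure weight_shift[of a a' b' b K F])
qed simp_all

text \<open>Neither window need contain the other, so both are compared with their hull.\<close>

lemma path_law_eq:
  assumes "r < a" "a \<le> b" "b < v" "r < a'" "a' \<le> b'" "b' < v"
    and "finite J" "J \<subseteq> {a..b}" "J \<subseteq> {a'..b'}"
  shows "path_law a b J = path_law a' b' J"
proof -
  have "path_law (min a a') (max b b') J = path_law a b J"
    using assms by (intro path_law_shrink) auto
  moreover have "path_law (min a a') (max b b') J = path_law a' b' J"
    using assms by (intro path_law_shrink) auto
  ultimately show ?thesis by simp
qed

lemma distr_path_law:
  assumes "r < a" "a \<le> b" "b < v" "J \<subseteq> H" "H \<subseteq> {a..b}"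
  shows "distr (path_law a b H) (PiM J (\<lambda>_. borel)) (\<lambda>f. restrict f J) = path_law a b J"
proof -
  have H: "at_times Z H \<in> tilted a b \<rightarrow>\<^sub>M PiM H (\<lambda>_. borel)"
    using at_times_Z_measurable[of a b H] assms by (simp add: measurable_cong_sets[OF sets_tilted refl])
  have "(\<lambda>f. restrict f J) \<circ> at_times Z H = at_times Z J"
    using assms by (auto simp: restrict_at_times)
  then show ?thesis
    using assms H by (simp add: path_law_def distr_distr measurable_restrict_subset)
qed

text \<open>The midpoint is inserted only to make \<open>Min\<close> and \<open>Max\<close> meaningful for \<open>J = {}\<close>.\<close>

definition bridge_law :: "real set \<Rightarrow> (real \<Rightarrow> real) measure" where
  "bridge_law J = path_law (Min (insert ((r + v) / 2) J)) (Max (insert ((r + v) / 2) J)) J"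

lemma finite_times_bounds:
  assumes "finite J" "J \<subseteq> {r<..<v}"
  defines "K \<equiv> insert ((r + v) / 2) J"
  shows "r < Min K" "Min K \<le> Max K" "Max K < v" "J \<subseteq> {Min K..Max K}"
proof -
  have K: "finite K" "K \<noteq> {}" "K \<subseteq> {r<..<v}"
    using assms rv(3) by auto
  have "Min K \<in> {r<..<v}" "Max K \<in> {r<..<v}"
    using K Min_in[of K] Max_in[of K] by blast+
  then show "r < Min K" "Max K < v" by auto
  show "Min K \<le> Max K"
    using K by (meson Max_ge Min_in)
  show "J \<subseteq> {Min K..Max K}"
    using K by (auto simp: K_def)
qed

text \<open>Frees \<open>bridge_law\<close> from its canonical window, so that different sets of
  times can share one.\<close>

lemma bridge_law_eq:
  assumes "r < a" "a \<le> b" "b < v" "finite J" "J \<subseteq> {a..b}"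
  shows "bridge_law J = path_law a b J"
proof -
  have "J \<subseteq> {r<..<v}"
    using assms by auto
  then show ?thesis
    unfolding bridge_law_def using assms finite_times_bounds[of J] by (intro path_law_eq) auto
qed

text \<open>In the window of the larger set \<open>H\<close> both laws are images of the same tilted
  measure, and one is visibly a marginal of the other.\<close>

lemma polish_projective_bridge_law: "polish_projective {r<..<v} bridge_law"
proof (intro polish_projective.intro projective_family.intro)
  fix J H assume JH: "J \<subseteq> H" "finite H" "H \<subseteq> {r<..<v}"
  obtain a b where ab: "r < a" "a \<le> b" "b < v" "H \<subseteq> {a..b}"
    by (rule that[OF finite_times_bounds[OF JH(2,3)]])
  then show "bridge_law J = distr (bridge_law H) (PiM J (\<lambda>_. borel)) (\<lambda>f. restrict f J)"
    using JH finite_subset[OF JH(1,2)] by (subst (1 2) bridge_law_eq[of a b]) (auto simp: distr_path_law)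
next
  fix J assume J: "finite J" "J \<subseteq> {r<..<v}"
  obtain a b where ab: "r < a" "a \<le> b" "b < v" "J \<subseteq> {a..b}"
    by (rule that[OF finite_times_bounds[OF J]])
  then show "prob_space (bridge_law J)"
    using J by (simp add: bridge_law_eq prob_space_path_law)
qed

section \<open>The bridge\<close>

definition bridge_measure :: "(real \<Rightarrow> real) measure" where
  "bridge_measure = projective_family.lim {r<..<v} bridge_law (\<lambda>_. borel)"

lemma sets_bridge_measure [measurable_cong, simp]:
  "sets bridge_measure = sets (PiM {r<..<v} (\<lambda>_. borel))"
proof -
  interpret bridge: polish_projective "{r<..<v}" bridge_law
    by (rule polish_projective_bridge_law)
  show ?thesis by (simp add: bridge_measure_def)
qed

lemma space_bridge_measure: "space bridge_measure = {r<..<v} \<rightarrow>\<^sub>E UNIV"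
  using sets_eq_imp_space_eq[OF sets_bridge_measure] by (simp add: space_PiM)

sublocale bridge: prob_space bridge_measure
proof -
  interpret bridge: polish_projective "{r<..<v}" bridge_law
    by (rule polish_projective_bridge_law)
  show "prob_space bridge_measure"
    unfolding bridge_measure_def by (rule bridge.P.prob_space_axioms)
qed

abbreviation X :: "real \<Rightarrow> (real \<Rightarrow> real) \<Rightarrow> real" where
  "X \<equiv> \<lambda>t f. f t"

lemma X_measurable [measurable (raw)]:
  "t \<in> {r<..<v} \<Longrightarrow> X t \<in> borel_measurable bridge_measure"
  by (simp add: measurable_cong_sets[OF sets_bridge_measure refl])

lemma at_times_X_measurable:
  "J \<subseteq> {r<..<v} \<Longrightarrow> at_times X J \<in> bridge_measure \<rightarrow>\<^sub>M PiM J (\<lambda>_. borel)"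
  by (rule at_times_measurable) (auto intro: X_measurable)

lemma distr_at_times_X:
  assumes J: "finite J" "J \<subseteq> {r<..<v}"
  shows "distr bridge_measure (PiM J (\<lambda>_. borel)) (at_times X J) = bridge_law J"
proof (rule measure_eqI)
  interpret bridge: polish_projective "{r<..<v}" bridge_law
    by (rule polish_projective_bridge_law)
  show sets: "sets (distr bridge_measure (PiM J (\<lambda>_. borel)) (at_times X J)) = sets (bridge_law J)"
    by (simp add: bridge_law_def)
  fix A assume "A \<in> sets (distr bridge_measure (PiM J (\<lambda>_. borel)) (at_times X J))"
  then have A: "A \<in> sets (PiM J (\<lambda>_. borel))" by simp
  have "emeasure (distr bridge_measure (PiM J (\<lambda>_. borel)) (at_times X J)) A
      = emeasure bridge_measure (at_times X J -` A \<inter> space bridge_measure)"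
    using A at_times_X_measurable J by (simp add: emeasure_distr)
  \<comment> \<open>On path space \<open>at_times X J\<close> is restriction to \<open>J\<close>, so
    the preimage is a cylinder, whose mass \<open>bridge_law J\<close> prescribes.\<close>
  also have "at_times X J -` A \<inter> space bridge_measure = prod_emb {r<..<v} (\<lambda>_. borel) J A"
    by (auto simp: prod_emb_def space_bridge_measure at_times_def)
  also have "emeasure bridge_measure \<dots> = emeasure (bridge_law J) A"
    unfolding bridge_measure_def using J A by (intro bridge.emeasure_lim_emb) auto
  finally show "emeasure (distr bridge_measure (PiM J (\<lambda>_. borel)) (at_times X J)) A = emeasure (bridge_law J) A" .
qed

text \<open>The dictionary between the bridge and \<open>Z\<close>: integrals over \<open>X\<close>
  become weighted integrals over \<open>Z\<close>, where the Markov property is available, and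
  back.\<close>

lemma nn_integral_bridge:
  assumes "r < a" "a \<le> b" "b < v" "finite J" "J \<subseteq> {a..b}"
    and G: "G \<in> borel_measurable (PiM J (\<lambda>_. borel))"
  shows "(\<integral>\<^sup>+f. G (at_times X J f) \<partial>bridge_measure)
    = (\<integral>\<^sup>+\<omega>. weight a b \<omega> * G (at_times Z J \<omega>) \<partial>\<Omega>) / p r zr v zv"
proof -
  have J: "J \<subseteq> {r<..<v}"
    using assms by auto
  then have "(\<integral>\<^sup>+f. G (at_times X J f) \<partial>bridge_measure)
      = (\<integral>\<^sup>+f. G f \<partial>distr bridge_measure (PiM J (\<lambda>_. borel)) (at_times X J))"
    using G at_times_X_measurable by (simp add: nn_integral_distr)
  also have "\<dots> = (\<integral>\<^sup>+f. G f \<partial>path_law a b J)"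
    using assms J by (simp add: distr_at_times_X bridge_law_eq)
  finally show ?thesis
    using assms by (simp add: nn_integral_path_law)
qed

section \<open>Absolute continuity and endpoint limits\<close>

text \<open>\<open>tilted a b\<close> has a density with respect to \<open>\<Omega>\<close>, and
  absolute continuity passes to images under the same map.\<close>

lemma absolutely_continuous_bridge:
  assumes J: "finite J" "J \<subseteq> {r<..<v}"
  shows "absolutely_continuous (distr \<Omega> (PiM J (\<lambda>_. borel)) (at_times Z J))
    (distr bridge_measure (PiM J (\<lambda>_. borel)) (at_times X J))"
proof -
  obtain a b where ab: "r < a" "a \<le> b" "b < v" "J \<subseteq> {a..b}"
    by (rule that[OF finite_times_bounds[OF J]])
  note [measurable] = at_times_Z_measurable[OF ab(1,3,4)] weight_measurable[OF ab(1-3)]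
  have ac: "absolutely_continuous \<Omega> (tilted a b)"
    unfolding tilted_def by (rule absolutely_continuousI_density) simp
  have Z': "at_times Z J \<in> tilted a b \<rightarrow>\<^sub>M PiM J (\<lambda>_. borel)"
    by (simp add: measurable_cong_sets[OF sets_tilted refl])
  have space: "space (tilted a b) = space \<Omega>"
    by (simp add: tilted_def)
  have "absolutely_continuous (distr \<Omega> (PiM J (\<lambda>_. borel)) (at_times Z J)) (path_law a b J)"
    unfolding path_law_def absolutely_continuous_def
    using ac Z' by (auto simp: null_sets_distr_iff space absolutely_continuous_def)
  then show ?thesis
    using J ab by (simp add: distr_at_times_X bridge_law_eq)
qed

text \<open>Serves to carry almost sure relations between Borel functions of finitely many
  coordinates from \<open>Z\<close> to \<open>X\<close>.\<close>

lemma AE_bridge: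
  assumes J: "finite J" "J \<subseteq> {r<..<v}"
    and Q: "Measurable.pred (PiM J (\<lambda>_. borel)) Q"
    and AE: "AE \<omega> in \<Omega>. Q (at_times Z J \<omega>)"
  shows "AE f in bridge_measure. Q (at_times X J f)"
proof -
  obtain a b where ab: "r < a" "a \<le> b" "b < v" "J \<subseteq> {a..b}"
    by (rule that[OF finite_times_bounds[OF J]])
  have "AE f in distr \<Omega> (PiM J (\<lambda>_. borel)) (at_times Z J). Q f"
    using AE Q at_times_Z_measurable[OF ab(1,3,4)] by (subst AE_distr_iff) (auto simp: pred_def)
  then have "AE f in distr bridge_measure (PiM J (\<lambda>_. borel)) (at_times X J). Q f"
    by (intro absolutely_continuous_AE[OF _ absolutely_continuous_bridge[OF J]]) auto
  then show ?thesis
    by (rule AE_distrD[OF at_times_X_measurable[OF J(2)]])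
qed

text \<open>In the window consisting of \<open>t\<close> alone, \<open>X t\<close> has density
  \<open>q r zr t y * q t y v zv / p r zr v zv\<close> relative to \<open>\<pi> t\<close>, so its
  tail probability is the assumed integral up to a constant. Leaving \<open>z\<close> and
  \<open>F\<close> free covers both endpoints.\<close>

lemma bridge_limit:
  assumes lim: "((\<lambda>t. \<integral>\<^sup>+y\<in>{y \<in> M t. \<bar>y - z\<bar> > \<epsilon>}. (p r zr t y * p t y v zv) \<partial>\<pi> t) \<longlongrightarrow> 0) F"
    and F: "eventually (\<lambda>t. t \<in> {r<..<v}) F"
  shows "((\<lambda>t. measure bridge_measure {f \<in> space bridge_measure. \<bar>X t f - z\<bar> > \<epsilon>}) \<longlongrightarrow> 0) F"
proof -
  let ?I = "\<lambda>t. \<integral>\<^sup>+y\<in>{y \<in> M t. \<bar>y - z\<bar> > \<epsilon>}. (p r zr t y * p t y v zv) \<partial>\<pi> t"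
  have eq: "measure bridge_measure {f \<in> space bridge_measure. \<bar>X t f - z\<bar> > \<epsilon>}
      = enn2real (?I t * inverse (p r zr v zv))" if t: "t \<in> {r<..<v}" for t
  proof -
    have T [simp]: "t \<in> T" "r \<in> T" "v \<in> T" "r < t" "t < v"
      using t in_T rv by auto
    let ?B = "{y. \<bar>y - z\<bar> > \<epsilon>}"
    have [measurable]: "?B \<in> sets borel" by measurable
    have [measurable]: "X t \<in> borel_measurable bridge_measure" using t by (rule X_measurable)
    have "{f \<in> space bridge_measure. \<bar>X t f - z\<bar> > \<epsilon>} = X t -` ?B \<inter> space bridge_measure"
      by auto
    also have "\<dots> \<in> sets bridge_measure"
      by (rule measurable_sets[OF X_measurable[OF t]]) simp
    finally have sets: "{f \<in> space bridge_measure. \<bar>X t f - z\<bar> > \<epsilon>} \<in> sets bridge_measure" .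
    have "emeasure bridge_measure {f \<in> space bridge_measure. \<bar>X t f - z\<bar> > \<epsilon>}
        = (\<integral>\<^sup>+f. indicator ?B (at_times X {t} f t) \<partial>bridge_measure)"
      by (subst nn_integral_indicator[OF sets, symmetric])
         (auto simp: at_times_def indicator_def intro!: nn_integral_cong)
    also have "\<dots> = (\<integral>\<^sup>+\<omega>. weight t t \<omega> * indicator ?B (Z t \<omega>) \<partial>\<Omega>) / p r zr v zv"
      by (subst nn_integral_bridge[of t t]) (auto simp: at_times_def)
    also have "(\<integral>\<^sup>+\<omega>. weight t t \<omega> * indicator ?B (Z t \<omega>) \<partial>\<Omega>)
        = (\<integral>\<^sup>+y. q r zr t y * q t y v zv * indicator ?B y \<partial>\<pi> t)"
      unfolding weight_def by (rule nn_integral_\<pi>[symmetric]) auto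
    also have "\<dots> = ?I t"
      using zr zv by (intro nn_integral_cong) (auto simp: q_def indicator_def)
    finally show ?thesis
      by (simp add: measure_def divide_ennreal_def)
  qed
  \<comment> \<open>\<open>endpoint_pos\<close> keeps the inverse finite and so avoids
    \<open>0 * \<top>\<close>, where multiplication in \<open>ennreal\<close> is
    discontinuous.\<close>
  have "((\<lambda>t. ?I t * inverse (p r zr v zv)) \<longlongrightarrow> 0 * inverse (p r zr v zv)) F"
    using lim endpoint_pos by (intro tendsto_mult_ennreal) auto
  then have "((\<lambda>t. enn2real (?I t * inverse (p r zr v zv))) \<longlongrightarrow> 0) F"
    by (intro tendsto_enn2real) auto
  then show ?thesis
    by (rule Lim_transform_eventually) (use F in \<open>auto elim!: eventually_mono simp: eq\<close>)
qed

section \<open>Markov property of the bridge\<close>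

text \<open>
  Where \<open>q s x v zv = 0\<close> the numerator vanishes as well (see \<open>bridge_kernel_mult\<close>), and \<open>0 / 0 = 0\<close>.
\<close>

definition bridge_kernel :: "real \<Rightarrow> real \<Rightarrow> real set \<Rightarrow> real \<Rightarrow> ennreal" where
  "bridge_kernel s t B x = kernel s t (\<lambda>y. indicator B y * q t y v zv) x / q s x v zv"

lemma bridge_kernel_measurable:
  assumes "r < s" "s < t" "t < v" and [measurable]: "B \<in> sets borel"
  shows "bridge_kernel s t B \<in> borel_measurable borel"
proof -
  have [simp]: "s \<in> T" "t \<in> T" "v \<in> T" "s < t" "t < v" "s < v"
    using assms rv by (auto intro!: in_T)
  show ?thesis
    unfolding bridge_kernel_def[abs_def] by measurable
qed

text \<open>By harmonicity the numerator is at most \<open>q s x v zv\<close>, so it vanishes where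
  the denominator does; elsewhere the denominator is finite and cancels.\<close>

lemma bridge_kernel_mult:
  assumes "r < s" "s < t" "t < v"
  shows "q s x v zv * bridge_kernel s t B x = kernel s t (\<lambda>y. indicator B y * q t y v zv) x"
proof (cases "q s x v zv = 0")
  case True
  have "kernel s t (\<lambda>y. indicator B y * q t y v zv) x \<le> kernel s t (\<lambda>y. q t y v zv) x"
    unfolding kernel_def by (intro nn_integral_mono) (auto simp: indicator_def)
  also have "\<dots> = 0"
    using True assms by (simp add: kernel_endpoint)
  finally show ?thesis
    using True by simp
next
  case False
  moreover have "q s x v zv \<noteq> \<top>"
    using q_finite[of s v x zv] in_T assms rv by auto
  ultimately show ?thesis
    unfolding bridge_kernel_def by (simp add: ennreal_times_divide ennreal_mult_divide_eq mult.commute[of "q s x v zv"])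
qed

text \<open>In terms of \<open>Z\<close>, the event \<open>B\<close> and the exit factor at
  \<open>t\<close> are projected onto \<open>Z s\<close>. Then \<open>bridge_kernel_mult\<close>
  splits off the exit factor at \<open>s\<close>, which restores a weight, now
  \<open>weight a s\<close>, and leads back to the bridge.\<close>

lemma bridge_markov_product:
  assumes st: "r < s" "s < t" "t < v" and K: "finite K" "K \<subseteq> {r<..s}"
    and B [measurable]: "B \<in> sets borel" and F: "\<And>u. F u \<in> borel_measurable borel"
  shows "(\<integral>\<^sup>+f. (\<Prod>u\<in>K. F u (X u f)) * indicator B (X t f) \<partial>bridge_measure)
    = (\<integral>\<^sup>+f. (\<Prod>u\<in>K. F u (X u f)) * bridge_kernel s t B (X s f) \<partial>bridge_measure)"
proof -
  \<comment> \<open>Earliest time involved; inserting \<open>s\<close> ensures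
    \<open>a \<le> s\<close> and covers \<open>K = {}\<close>.\<close>
  define a where "a = Min (insert s K)"
  have a: "r < a" "a \<le> s" "K \<subseteq> {a..s}"
    using K st by (auto simp: a_def)
  have T [simp]: "s \<in> T" "t \<in> T" "r \<in> T" "v \<in> T" "a \<in> T"
    using a st by (auto intro!: in_T)
  have KT: "K \<subseteq> T" using K st by (auto intro!: in_T)
  have le: "a \<le> t" using a st by simp
  have endpoint: "q s x v zv * bridge_kernel s t B x = kernel s t (\<lambda>y. indicator B y * q t y v zv) x" for x
    by (rule bridge_kernel_mult[OF st])
  have [measurable]: "bridge_kernel s t B \<in> borel_measurable borel"
    using st B by (rule bridge_kernel_measurable)
  have prod_at_times: "(\<Prod>u\<in>K. F u (at_times Y H \<omega> u)) = (\<Prod>u\<in>K. F u (Y u \<omega>))"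
    if "K \<subseteq> H" for Y :: "real \<Rightarrow> 'b \<Rightarrow> real" and H \<omega>
    using that by (intro prod.cong) (auto simp: at_times_def)
  have prod_meas: "(\<lambda>f. \<Prod>u\<in>K. F u (f u)) \<in> borel_measurable (PiM H (\<lambda>_. borel))" if "K \<subseteq> H" for H
    using that by (intro borel_measurable_prod_ennreal measurable_compose[OF _ F] measurable_component_singleton) auto
  have W: "(\<lambda>\<omega>. q r zr a (Z a \<omega>) * (\<Prod>u\<in>K. F u (Z u \<omega>))) \<in> borel_measurable (sigma_gen \<Omega> Z {u \<in> T. u \<le> s})"
    using a K KT
    by (intro borel_measurable_times_ennreal borel_measurable_prod_ennreal measurable_compose[OF _ F]
        q_measurable' sigma_gen_past_measurable) auto
  have "(\<integral>\<^sup>+f. (\<Prod>u\<in>K. F u (X u f)) * indicator B (X t f) \<partial>bridge_measure)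
      = (\<integral>\<^sup>+f. (\<lambda>g. (\<Prod>u\<in>K. F u (g u)) * indicator B (g t)) (at_times X (insert t K) f) \<partial>bridge_measure)"
    by (simp add: prod_at_times subset_insertI) (simp add: at_times_def)
  also have "\<dots> = (\<integral>\<^sup>+\<omega>. weight a t \<omega> * (\<lambda>g. (\<Prod>u\<in>K. F u (g u)) * indicator B (g t)) (at_times Z (insert t K) \<omega>) \<partial>\<Omega>) / p r zr v zv"
    using a st K le by (intro nn_integral_bridge borel_measurable_times_ennreal prod_meas) auto
  also have "(\<integral>\<^sup>+\<omega>. weight a t \<omega> * (\<lambda>g. (\<Prod>u\<in>K. F u (g u)) * indicator B (g t)) (at_times Z (insert t K) \<omega>) \<partial>\<Omega>)
      = (\<integral>\<^sup>+\<omega>. (q r zr a (Z a \<omega>) * (\<Prod>u\<in>K. F u (Z u \<omega>))) * (\<lambda>y. indicator B y * q t y v zv) (Z t \<omega>) \<partial>\<Omega>)"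
    by (simp add: prod_at_times subset_insertI weight_def mult_ac) (simp add: at_times_def mult_ac)
  also have "\<dots> = (\<integral>\<^sup>+\<omega>. (q r zr a (Z a \<omega>) * (\<Prod>u\<in>K. F u (Z u \<omega>))) * kernel s t (\<lambda>y. indicator B y * q t y v zv) (Z s \<omega>) \<partial>\<Omega>)"
    using st W by (intro markov_step) auto
  also have "\<dots> = (\<integral>\<^sup>+\<omega>. weight a s \<omega> * (\<lambda>g. (\<Prod>u\<in>K. F u (g u)) * bridge_kernel s t B (g s)) (at_times Z (insert s K) \<omega>) \<partial>\<Omega>)"
    unfolding endpoint[symmetric]
    by (simp add: prod_at_times subset_insertI weight_def mult_ac) (simp add: at_times_def mult_ac)
  also have "\<dots> / p r zr v zv = (\<integral>\<^sup>+f. (\<lambda>g. (\<Prod>u\<in>K. F u (g u)) * bridge_kernel s t B (g s)) (at_times X (insert s K) f) \<partial>bridge_measure)"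
    using a st K by (intro nn_integral_bridge[symmetric] borel_measurable_times_ennreal prod_meas) auto
  also have "\<dots> = (\<integral>\<^sup>+f. (\<Prod>u\<in>K. F u (X u f)) * bridge_kernel s t B (X s f) \<partial>bridge_measure)"
    by (simp add: prod_at_times subset_insertI) (simp add: at_times_def)
  finally show ?thesis .
qed

text \<open>Both the full past and \<open>{s}\<close> are admissible as \<open>H\<close> and lead to
  the same function of \<open>X s\<close>; this is the Markov property.
  \<open>bridge_markov_product\<close> settles cylinders only, hence the detour through
  measures.\<close>

lemma bridge_cond_prob:
  assumes st: "r < s" "s < t" "t < v" and H: "s \<in> H" "H \<subseteq> {r<..s}" and B [measurable]: "B \<in> sets borel"
  shows "AE f in bridge_measure. ennreal (real_cond_exp bridge_measure (sigma_gen bridge_measure X H)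
      (\<lambda>f. indicator B (X t f)) f) = bridge_kernel s t B (X s f)"
proof -
  let ?G = "sigma_gen bridge_measure X H"
  have X_H: "u \<in> H \<Longrightarrow> X u \<in> borel_measurable bridge_measure" for u
    using H st by (intro X_measurable) auto
  have G: "sigma_finite_subalgebra bridge_measure ?G"
    using X_H by (rule bridge.sigma_finite_subalgebra_sigma_gen)
  interpret G: sigma_finite_subalgebra bridge_measure ?G by (rule G)
  have "r < t" "s < v"
    using st by linarith+
  then have [measurable]: "X t \<in> borel_measurable bridge_measure" "X s \<in> borel_measurable bridge_measure"
    using st by (auto intro!: X_measurable)
  have [measurable]: "at_times X H \<in> bridge_measure \<rightarrow>\<^sub>M PiM H (\<lambda>_. borel)"
    using X_H by (rule at_times_measurable)
  have [measurable]: "bridge_kernel s t B \<in> borel_measurable borel"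
    using st by (rule bridge_kernel_measurable) simp
  define A where "A = X t -` B \<inter> space bridge_measure"
  have [measurable]: "A \<in> sets bridge_measure" unfolding A_def by measurable
  \<comment> \<open>The two sides of the equation defining the conditional expectation, as measures
    on paths over the possibly infinite set \<open>H\<close>.\<close>
  let ?D1 = "distr (density bridge_measure (indicator A)) (PiM H (\<lambda>_. borel)) (at_times X H)"
  let ?D2 = "distr (density bridge_measure (\<lambda>f. bridge_kernel s t B (X s f))) (PiM H (\<lambda>_. borel)) (at_times X H)"
  have "?D1 = ?D2"
  proof (rule measure_eqI_PiM_infinite)
    \<comment> \<open>Uniqueness from cylinders requires finite mass; here it is the probability of
      \<open>A\<close>.\<close>
    have "emeasure (density bridge_measure (indicator A)) (space bridge_measure) = emeasure bridge_measure A"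
      using sets.sets_into_space[of A bridge_measure]
      by (simp add: emeasure_restricted Int_absorb2 del: sets_bridge_measure)
    then have "finite_measure (density bridge_measure (indicator A))"
      by (intro finite_measureI) (simp add: bridge.emeasure_eq_measure)
    then show "finite_measure ?D1"
      by (rule finite_measure.finite_measure_distr) simp
    fix C :: "real \<Rightarrow> real set" and K
    assume K: "finite K" "K \<subseteq> H" and C: "\<And>i. i \<in> K \<Longrightarrow> C i \<in> sets borel"
    let ?E = "prod_emb H (\<lambda>_. borel) K (PiE K C)"
    have [measurable]: "?E \<in> sets (PiM H (\<lambda>_. borel))"
      using K C by (intro sets_PiM_I) auto
    define F where "F u = (if u \<in> K then indicator (C u) else (\<lambda>_. 1) :: real \<Rightarrow> ennreal)" for u
    have F: "F u \<in> borel_measurable borel" for u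
      using C by (auto simp: F_def)
    have ind: "indicator ?E (at_times X H f) = (\<Prod>u\<in>K. F u (X u f))" for f
      using K by (simp add: indicator_at_times_emb F_def)
    have D: "emeasure (distr (density bridge_measure w) (PiM H (\<lambda>_. borel)) (at_times X H)) ?E
        = (\<integral>\<^sup>+f. (\<Prod>u\<in>K. F u (X u f)) * w f \<partial>bridge_measure)"
      if [measurable]: "w \<in> borel_measurable bridge_measure" for w
    proof -
      have "emeasure (distr (density bridge_measure w) (PiM H (\<lambda>_. borel)) (at_times X H)) ?E
          = (\<integral>\<^sup>+f. w f * indicator ?E (at_times X H f) \<partial>bridge_measure)"
      proof -
        have "(\<lambda>f. indicator ?E (at_times X H f) :: ennreal) \<in> borel_measurable bridge_measure"
          by measurable
        then have "(\<integral>\<^sup>+f. indicator ?E f \<partial>distr (density bridge_measure w) (PiM H (\<lambda>_. borel)) (at_times X H))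
            = (\<integral>\<^sup>+f. w f * indicator ?E (at_times X H f) \<partial>bridge_measure)"
          by (subst nn_integral_distr, simp, simp) (rule nn_integral_density, simp_all)
        then show ?thesis by simp
      qed
      then show ?thesis
        by (simp add: ind mult.commute)
    qed
    have "emeasure ?D1 ?E = (\<integral>\<^sup>+f. (\<Prod>u\<in>K. F u (X u f)) * indicator B (X t f) \<partial>bridge_measure)"
      by (subst D) (auto simp: A_def indicator_def intro!: nn_integral_cong)
    also have "\<dots> = emeasure ?D2 ?E"
      using st K H F by (subst bridge_markov_product[where s=s]) (auto simp: D)
    finally show "emeasure ?D1 ?E = emeasure ?D2 ?E" .
  qed simp_all
  then have eq: "emeasure ?D1 C = emeasure ?D2 C" for C by simp
  have "AE f in bridge_measure. bridge_kernel s t B (X s f) = nn_cond_exp bridge_measure ?G (indicator A) f"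
  proof (rule G.nn_cond_exp_charact)
    show "(\<lambda>f. bridge_kernel s t B (X s f)) \<in> borel_measurable ?G"
      using H by (intro measurable_compose[OF component_measurable_sigma_gen]) auto
    fix E assume "E \<in> sets ?G"
    then obtain C where C [measurable]: "C \<in> sets (PiM H (\<lambda>_. borel))"
      and E: "E = at_times X H -` C \<inter> space bridge_measure"
      by (auto simp: sets_sigma_gen)
    have D: "(\<integral>\<^sup>+f\<in>E. w f \<partial>bridge_measure)
        = emeasure (distr (density bridge_measure w) (PiM H (\<lambda>_. borel)) (at_times X H)) C"
      if [measurable]: "w \<in> borel_measurable bridge_measure" for w
    proof -
      have "E \<in> sets bridge_measure"
        unfolding E by (rule measurable_sets[OF _ C]) measurable
      then show ?thesis
        by (simp add: emeasure_distr emeasure_density E del: sets_bridge_measure)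
    qed
    show "(\<integral>\<^sup>+f\<in>E. indicator A f \<partial>bridge_measure)
        = (\<integral>\<^sup>+f\<in>E. bridge_kernel s t B (X s f) \<partial>bridge_measure)"
      by (simp add: D eq)
  qed simp
  moreover have "AE f in bridge_measure. nn_cond_exp bridge_measure ?G (indicator A) f
      = ennreal (real_cond_exp bridge_measure ?G (indicator A) f)"
    by (rule bridge.nn_cond_exp_indicator[OF G]) measurable
  moreover have "AE f in bridge_measure. real_cond_exp bridge_measure ?G (\<lambda>f. indicator B (X t f)) f
      = real_cond_exp bridge_measure ?G (indicator A) f"
    by (rule G.real_cond_exp_cong) (auto simp: A_def indicator_def)
  ultimately show ?thesis
    by eventually_elim simp
qed

lemma real_process_bridge: "real_process bridge_measure {r<..<v} X"
  using X_measurable bridge.prob_space_axioms by (auto simp: real_process_def)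

lemma markov_process_bridge: "markov_process bridge_measure {r<..<v} X"
  unfolding markov_process_def
proof (intro conjI ballI impI real_process_bridge)
  fix s t and B :: "real set"
  assume s: "s \<in> {r<..<v}" and t: "t \<in> {r<..<v}" and st: "s < t" and B [measurable]: "B \<in> sets borel"
  \<comment> \<open>\<open>ennreal\<close> sends all negative numbers to 0, so equality of the reals
    follows from \<open>bridge_cond_prob\<close> only with their sign known.\<close>
  have nonneg: "AE f in bridge_measure. 0 \<le> real_cond_exp bridge_measure (sigma_gen bridge_measure X H)
      (\<lambda>f. indicator B (X t f)) f" if "H \<subseteq> {r<..<v}" for H
  proof -
    interpret sigma_finite_subalgebra bridge_measure "sigma_gen bridge_measure X H"
      using that by (intro bridge.sigma_finite_subalgebra_sigma_gen X_measurable) auto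
    have [measurable]: "X t \<in> borel_measurable bridge_measure"
      using t by (rule X_measurable)
    show ?thesis by (rule real_cond_exp_pos) auto
  qed
  let ?H = "{u \<in> {r<..<v}. u \<le> s}"
  have "AE f in bridge_measure. ennreal (real_cond_exp bridge_measure (sigma_gen bridge_measure X ?H)
      (\<lambda>f. indicator B (X t f)) f) = bridge_kernel s t B (X s f)"
    using s t st by (intro bridge_cond_prob B) auto
  moreover have "AE f in bridge_measure. ennreal (real_cond_exp bridge_measure (sigma_gen bridge_measure X {s})
      (\<lambda>f. indicator B (X t f)) f) = bridge_kernel s t B (X s f)"
    using s t st by (intro bridge_cond_prob B) auto
  moreover have "AE f in bridge_measure. 0 \<le> real_cond_exp bridge_measure (sigma_gen bridge_measure X ?H)
      (\<lambda>f. indicator B (X t f)) f"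
    by (rule nonneg) auto
  moreover have "AE f in bridge_measure. 0 \<le> real_cond_exp bridge_measure (sigma_gen bridge_measure X {s})
      (\<lambda>f. indicator B (X t f)) f"
    using s by (intro nonneg) auto
  ultimately show "AE f in bridge_measure.
      real_cond_exp bridge_measure (sigma_gen bridge_measure X ?H) (\<lambda>f. indicator B (X t f)) f
      = real_cond_exp bridge_measure (sigma_gen bridge_measure X {s}) (\<lambda>f. indicator B (X t f)) f"
    by eventually_elim (simp add: ennreal_inj[symmetric] del: ennreal_inj)
qed

section \<open>Conditioning on times on both sides\<close>

text \<open>
  Defining \<open>k\<close> as a Radon-Nikodym derivative on the path space lets the same Borel function represent
  the conditional expectation for \<open>Z\<close> and for \<open>X\<close>.
\<close>

lemma bridge_nn_cond_exp:
  assumes SU: "finite H" "H \<noteq> {}" "H \<subseteq> {r<..<v}" and J: "finite J" "J \<subseteq> {Min H..Max H}"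
    and g [measurable]: "g \<in> borel_measurable (PiM J (\<lambda>_. borel))"
  obtains k :: "(real \<Rightarrow> real) \<Rightarrow> ennreal" where "k \<in> borel_measurable (PiM H (\<lambda>_. borel))"
    "AE \<omega> in \<Omega>. nn_cond_exp \<Omega> (sigma_gen \<Omega> Z H) (\<lambda>\<omega>. g (at_times Z J \<omega>)) \<omega> = k (at_times Z H \<omega>)"
    "AE f in bridge_measure. nn_cond_exp bridge_measure (sigma_gen bridge_measure X H)
        (\<lambda>f. g (at_times X J f)) f = k (at_times X H f)"
proof -
  \<comment> \<open>The outermost times of \<open>H\<close> form the window, so
    \<open>weight a b\<close> is a function of \<open>at_times Z H\<close>.\<close>
  define a b where "a = Min H" and "b = Max H"
  have ab: "a \<in> H" "b \<in> H" "a \<le> b" "r < a" "b < v" "H \<subseteq> {a..b}" "J \<subseteq> {a..b}"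
    using SU J Min_in[of H] Max_in[of H] by (auto simp: a_def b_def)
  have HT: "H \<subseteq> T" and JI: "J \<subseteq> {r<..<v}" using SU ab by (auto intro!: in_T)
  have [simp]: "a \<in> T" "b \<in> T" "r \<in> T" "v \<in> T" using HT ab rv by auto
  have [measurable]: "at_times Z H \<in> \<Omega> \<rightarrow>\<^sub>M PiM H (\<lambda>_. borel)" "at_times Z J \<in> \<Omega> \<rightarrow>\<^sub>M PiM J (\<lambda>_. borel)"
    using ab by (auto intro!: at_times_Z_measurable[of a b])
  have [measurable]: "at_times X H \<in> bridge_measure \<rightarrow>\<^sub>M PiM H (\<lambda>_. borel)"
      "at_times X J \<in> bridge_measure \<rightarrow>\<^sub>M PiM J (\<lambda>_. borel)"
    using SU JI by (auto intro!: at_times_X_measurable)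
  interpret GZ: sigma_finite_subalgebra \<Omega> "sigma_gen \<Omega> Z H"
    using HT by (intro sigma_finite_subalgebra_sigma_gen Z_measurable) auto
  interpret GX: sigma_finite_subalgebra bridge_measure "sigma_gen bridge_measure X H"
    using SU by (intro bridge.sigma_finite_subalgebra_sigma_gen X_measurable) auto
  let ?N = "distr \<Omega> (PiM H (\<lambda>_. borel)) (at_times Z H)"
  let ?N' = "distr (density \<Omega> (\<lambda>\<omega>. g (at_times Z J \<omega>))) (PiM H (\<lambda>_. borel)) (at_times Z H)"
  interpret N: prob_space ?N by (rule prob_space_distr) simp
  define k where "k = RN_deriv ?N ?N'"
  have [measurable]: "k \<in> borel_measurable (PiM H (\<lambda>_. borel))"
    unfolding k_def using borel_measurable_RN_deriv[of ?N ?N'] by simp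
  have "absolutely_continuous \<Omega> (density \<Omega> (\<lambda>\<omega>. g (at_times Z J \<omega>)))"
    by (rule absolutely_continuousI_density) simp
  then have ac: "absolutely_continuous ?N ?N'"
    by (auto simp: absolutely_continuous_def null_sets_distr_iff)
  have key: "(\<integral>\<^sup>+\<omega>. W (at_times Z H \<omega>) * g (at_times Z J \<omega>) \<partial>\<Omega>)
      = (\<integral>\<^sup>+\<omega>. W (at_times Z H \<omega>) * k (at_times Z H \<omega>) \<partial>\<Omega>)"
    if [measurable]: "W \<in> borel_measurable (PiM H (\<lambda>_. borel))" for W
  proof -
    have "(\<integral>\<^sup>+\<omega>. W (at_times Z H \<omega>) * g (at_times Z J \<omega>) \<partial>\<Omega>) = (\<integral>\<^sup>+f. W f \<partial>?N')"
      by (simp add: nn_integral_distr nn_integral_density mult.commute)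
    also have "\<dots> = (\<integral>\<^sup>+f. k f * W f \<partial>?N)"
      unfolding k_def by (rule N.RN_deriv_nn_integral[OF ac]) auto
    finally show ?thesis
      by (simp add: nn_integral_distr mult.commute)
  qed
  have keyX: "(\<integral>\<^sup>+f. W (at_times X H f) * g (at_times X J f) \<partial>bridge_measure)
      = (\<integral>\<^sup>+f. W (at_times X H f) * k (at_times X H f) \<partial>bridge_measure)"
    if W [measurable]: "W \<in> borel_measurable (PiM H (\<lambda>_. borel))" for W
  proof -
    \<comment> \<open>The weight is absorbed into the test function, as \<open>a\<close> and
      \<open>b\<close> belong to \<open>H\<close>; \<open>key\<close> for \<open>W'\<close> then
      shows that tilting leaves \<open>k\<close> unchanged.\<close>
    define W' where "W' f = q r zr a (f a) * q b (f b) v zv * W f" for f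
    have [measurable]: "W' \<in> borel_measurable (PiM H (\<lambda>_. borel))"
      unfolding W'_def[abs_def] using ab
      by (intro borel_measurable_times_ennreal q_measurable' W measurable_component_singleton) auto
    have W': "weight a b \<omega> * (W (at_times Z H \<omega>) * c) = W' (at_times Z H \<omega>) * c" for \<omega> c
      using ab by (simp add: W'_def weight_def at_times_def mult_ac)
    have prod: "(\<lambda>f. W (restrict f H) * g (restrict f J)) \<in> borel_measurable (PiM (H \<union> J) (\<lambda>_. borel))"
      by (intro borel_measurable_times_ennreal measurable_compose[OF _ W] measurable_compose[OF _ g]
          measurable_restrict_subset) auto
    have "(\<integral>\<^sup>+f. W (at_times X H f) * g (at_times X J f) \<partial>bridge_measure)
        = (\<integral>\<^sup>+f. (\<lambda>f. W (restrict f H) * g (restrict f J)) (at_times X (H \<union> J) f) \<partial>bridge_measure)"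
      by (simp add: restrict_at_times)
    also have "\<dots> = (\<integral>\<^sup>+\<omega>. weight a b \<omega> * (\<lambda>f. W (restrict f H) * g (restrict f J)) (at_times Z (H \<union> J) \<omega>) \<partial>\<Omega>) / p r zr v zv"
      using ab SU J by (intro nn_integral_bridge prod) auto
    also have "\<dots> = (\<integral>\<^sup>+\<omega>. W' (at_times Z H \<omega>) * k (at_times Z H \<omega>) \<partial>\<Omega>) / p r zr v zv"
      by (simp add: restrict_at_times W' key)
    also have "\<dots> = (\<integral>\<^sup>+\<omega>. weight a b \<omega> * (\<lambda>f. W f * k f) (at_times Z H \<omega>) \<partial>\<Omega>) / p r zr v zv"
      by (simp add: W')
    also have "\<dots> = (\<integral>\<^sup>+f. (\<lambda>f. W f * k f) (at_times X H f) \<partial>bridge_measure)"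
      using ab SU J by (intro nn_integral_bridge[symmetric]) auto
    finally show ?thesis by simp
  qed
  have "AE \<omega> in \<Omega>. k (at_times Z H \<omega>) = nn_cond_exp \<Omega> (sigma_gen \<Omega> Z H) (\<lambda>\<omega>. g (at_times Z J \<omega>)) \<omega>"
  proof (rule GZ.nn_cond_exp_charact)
    show "(\<lambda>\<omega>. k (at_times Z H \<omega>)) \<in> borel_measurable (sigma_gen \<Omega> Z H)"
      by (rule measurable_compose[OF at_times_measurable_sigma_gen]) simp
    fix A assume "A \<in> sets (sigma_gen \<Omega> Z H)"
    then obtain C where C: "C \<in> sets (PiM H (\<lambda>_. borel))" and A: "A = at_times Z H -` C \<inter> space \<Omega>"
      by (auto simp: sets_sigma_gen)
    have ind: "\<omega> \<in> space \<Omega> \<Longrightarrow> indicator A \<omega> = (indicator C (at_times Z H \<omega>) :: ennreal)" for \<omega>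
      by (auto simp: A indicator_def)
    show "(\<integral>\<^sup>+\<omega>\<in>A. g (at_times Z J \<omega>) \<partial>\<Omega>) = (\<integral>\<^sup>+\<omega>\<in>A. k (at_times Z H \<omega>) \<partial>\<Omega>)"
      using key[of "indicator C"] C by (simp add: ind mult.commute cong: nn_integral_cong)
  qed simp
  moreover have "AE f in bridge_measure. k (at_times X H f)
      = nn_cond_exp bridge_measure (sigma_gen bridge_measure X H) (\<lambda>f. g (at_times X J f)) f"
  proof (rule GX.nn_cond_exp_charact)
    show "(\<lambda>f. k (at_times X H f)) \<in> borel_measurable (sigma_gen bridge_measure X H)"
      by (rule measurable_compose[OF at_times_measurable_sigma_gen]) simp
    fix A assume "A \<in> sets (sigma_gen bridge_measure X H)"
    then obtain C where C: "C \<in> sets (PiM H (\<lambda>_. borel))" and A: "A = at_times X H -` C \<inter> space bridge_measure"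
      by (auto simp: sets_sigma_gen)
    have ind: "f \<in> space bridge_measure \<Longrightarrow> indicator A f = (indicator C (at_times X H f) :: ennreal)" for f
      by (auto simp: A indicator_def)
    show "(\<integral>\<^sup>+f\<in>A. g (at_times X J f) \<partial>bridge_measure) = (\<integral>\<^sup>+f\<in>A. k (at_times X H f) \<partial>bridge_measure)"
      using keyX[of "indicator C"] C by (simp add: ind mult.commute cong: nn_integral_cong)
  qed simp
  ultimately show ?thesis
    by (intro that[of k]) (auto simp: eq_commute)
qed

text \<open>The positive and negative parts of \<open>g\<close> are represented by Borel functions
  \<open>k1\<close> and \<open>k2\<close> common to both processes. The hypothesis becomes an almost
  sure relation among \<open>k1\<close>, \<open>k2\<close> and \<open>h\<close> along
  \<open>Z\<close>, which \<open>AE_bridge\<close> moves to \<open>X\<close>.\<close>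

lemma bridge_real_cond_exp:
  assumes fin: "finite S" "finite J" "finite U" and ne: "S \<noteq> {}" "J \<noteq> {}" "U \<noteq> {}"
    and sub: "S \<union> J \<union> U \<subseteq> {r<..<v}"
    and less: "\<forall>s\<in>S. \<forall>t\<in>J. s < t" "\<forall>t\<in>J. \<forall>u\<in>U. t < u"
    and g [measurable]: "g \<in> borel_measurable (PiM J (\<lambda>_. borel))"
    and h [measurable]: "h \<in> borel_measurable (PiM S (\<lambda>_. borel) \<Otimes>\<^sub>M PiM U (\<lambda>_. borel))"
    and AE: "AE \<omega> in \<Omega>. real_cond_exp \<Omega> (sigma_gen \<Omega> Z (S \<union> U)) (\<lambda>\<omega>. g (at_times Z J \<omega>)) \<omega>
      = (h (at_times Z S \<omega>, at_times Z U \<omega>) :: real)"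
  shows "AE f in bridge_measure. real_cond_exp bridge_measure (sigma_gen bridge_measure X (S \<union> U))
      (\<lambda>f. g (at_times X J f)) f = h (at_times X S f, at_times X U f)"
proof -
  let ?H = "S \<union> U"
  have H: "finite ?H" "?H \<noteq> {}" "?H \<subseteq> {r<..<v}"
    using fin ne sub by auto
  have J: "J \<subseteq> {Min ?H..Max ?H}"
  proof
    fix t assume t: "t \<in> J"
    obtain s u where "s \<in> S" "u \<in> U" using ne by auto
    then have "Min ?H \<le> s" "u \<le> Max ?H" "s < t" "t < u"
      using H t less by auto
    then show "t \<in> {Min ?H..Max ?H}" by simp
  qed
  obtain k1 where k1 [measurable]: "k1 \<in> borel_measurable (PiM ?H (\<lambda>_. borel))"
    and Z1: "AE \<omega> in \<Omega>. nn_cond_exp \<Omega> (sigma_gen \<Omega> Z ?H) (\<lambda>\<omega>. ennreal (g (at_times Z J \<omega>))) \<omega> = k1 (at_times Z ?H \<omega>)"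
    and X1: "AE f in bridge_measure. nn_cond_exp bridge_measure (sigma_gen bridge_measure X ?H)
        (\<lambda>f. ennreal (g (at_times X J f))) f = k1 (at_times X ?H f)"
    by (rule bridge_nn_cond_exp[OF H fin(2) J, of "\<lambda>f. ennreal (g f)"]) auto
  obtain k2 where k2 [measurable]: "k2 \<in> borel_measurable (PiM ?H (\<lambda>_. borel))"
    and Z2: "AE \<omega> in \<Omega>. nn_cond_exp \<Omega> (sigma_gen \<Omega> Z ?H) (\<lambda>\<omega>. ennreal (- g (at_times Z J \<omega>))) \<omega> = k2 (at_times Z ?H \<omega>)"
    and X2: "AE f in bridge_measure. nn_cond_exp bridge_measure (sigma_gen bridge_measure X ?H)
        (\<lambda>f. ennreal (- g (at_times X J f))) f = k2 (at_times X ?H f)"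
    by (rule bridge_nn_cond_exp[OF H fin(2) J, of "\<lambda>f. ennreal (- g f)"]) auto
  \<comment> \<open>\<open>h\<close> takes a pair of vectors; read on the joint vector over
    \<open>S \<union> U\<close> it is comparable with \<open>k1\<close> and
    \<open>k2\<close>.\<close>
  define h' where "h' f = h (restrict f S, restrict f U)" for f
  let ?Q = "\<lambda>f. enn2real (k1 f) - enn2real (k2 f) = h' f"
  have [measurable]: "h' \<in> borel_measurable (PiM ?H (\<lambda>_. borel))"
    unfolding h'_def[abs_def]
    by (intro measurable_compose[OF _ h] measurable_Pair measurable_restrict_subset) auto
  have Q: "Measurable.pred (PiM ?H (\<lambda>_. borel)) ?Q"
    unfolding pred_def by (intro borel_measurable_eq borel_measurable_diff) simp_all
  have "AE \<omega> in \<Omega>. ?Q (at_times Z ?H \<omega>)"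
    using AE Z1 Z2 by eventually_elim (simp add: real_cond_exp_def h'_def restrict_at_times)
  then have "AE f in bridge_measure. ?Q (at_times X ?H f)"
    by (rule AE_bridge[OF H(1,3) Q])
  then show ?thesis
    using X1 X2 by eventually_elim (simp add: real_cond_exp_def h'_def restrict_at_times)
qed

end

theorem proposition1p2:
  fixes T :: "real set"
    and \<Omega> :: "'a measure"
    and Z :: "real \<Rightarrow> 'a \<Rightarrow> real"
    and \<pi> :: "real \<Rightarrow> real measure"
    and M :: "real \<Rightarrow> real set"
    and P :: "real \<Rightarrow> real \<Rightarrow> real \<Rightarrow> real measure"
    and p :: "real \<Rightarrow> real \<Rightarrow> real \<Rightarrow> real \<Rightarrow> ennreal"
    and r v zr zv :: real
  assumes "open T" and "is_interval T"
    and "markov_process \<Omega> T Z"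
    and "\<And>t. t \<in> T \<Longrightarrow> \<pi> t = distr \<Omega> borel (Z t)"
    and "\<And>t. t \<in> T \<Longrightarrow> M t \<in> sets borel"
    and "\<And>t. t \<in> T \<Longrightarrow> emeasure (\<pi> t) (M t) = 1"
    and "transition_probabilities \<Omega> T Z M P"
    and density_measurable: "\<And>s t. s \<in> T \<Longrightarrow> t \<in> T \<Longrightarrow> s < t \<Longrightarrow>
          (\<lambda>(x, y). p s x t y)
            \<in> borel_measurable (restrict_space borel (M s) \<Otimes>\<^sub>M restrict_space borel (M t))"
    and density_finite: "\<And>s t x y. s \<in> T \<Longrightarrow> t \<in> T \<Longrightarrow> s < t \<Longrightarrow> x \<in> M s \<Longrightarrow> y \<in> M t \<Longrightarrow>
          p s x t y < \<infinity>"
    and density: "\<And>s t x. s \<in> T \<Longrightarrow> t \<in> T \<Longrightarrow> s < t \<Longrightarrow> x \<in> M s \<Longrightarrow>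
          P s t x = density (\<pi> t) (\<lambda>y. p s x t y * indicator (M t) y)"
    and "r \<in> T" and "v \<in> T" and "r < v" and "zr \<in> M r" and "zv \<in> M v"
    \<comment> \<open>Chapman-Kolmogorov for the chosen version of the densities at the endpoint \<open>(v, zv)\<close>:
        the equation for \<open>P\<close> gives it only for \<open>\<pi> v\<close>-almost every endpoint.\<close>
    and chapman_kolmogorov: "\<And>s t x. r \<le> s \<Longrightarrow> s < t \<Longrightarrow> t < v \<Longrightarrow> x \<in> M s \<Longrightarrow>
          p s x v zv = (\<integral>\<^sup>+y\<in>M t. (p s x t y * p t y v zv) \<partial>\<pi> t)"
    and "0 < p r zr v zv" and "p r zr v zv < \<infinity>"
    and limit_r: "\<And>\<epsilon>. \<epsilon> > 0 \<Longrightarrow>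
          ((\<lambda>t. \<integral>\<^sup>+y\<in>{y \<in> M t. \<bar>y - zr\<bar> > \<epsilon>}. (p r zr t y * p t y v zv) \<partial>\<pi> t) \<longlongrightarrow> 0) (at_right r)"
    and limit_v: "\<And>\<epsilon>. \<epsilon> > 0 \<Longrightarrow>
          ((\<lambda>t. \<integral>\<^sup>+y\<in>{y \<in> M t. \<bar>y - zv\<bar> > \<epsilon>}. (p r zr t y * p t y v zv) \<partial>\<pi> t) \<longlongrightarrow> 0) (at_left v)"
  shows "\<exists>(N :: (real \<Rightarrow> real) measure) (X :: real \<Rightarrow> (real \<Rightarrow> real) \<Rightarrow> real).
           markov_process N {r<..<v} X \<and> is_bridge \<Omega> T Z r zr v zv N X"
proof -
  interpret bridge_setting T \<Omega> Z \<pi> M P p r v zr zv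
  proof
    show "real_process \<Omega> T Z"
      using assms(3) by (simp add: markov_process_def)
  qed (fact assms)+
  \<comment> \<open>\<open>bridge_limit\<close> identifies the tail probability only inside
    \<open>(r, v)\<close>, which contains all times close enough to either end on the relevant
    side.\<close>
  have "\<forall>\<^sub>F t in at_right r. t \<in> {r<..<v}"
    using eventually_at_right_less[of r] \<open>r < v\<close> by (auto simp: eventually_at_right_field)
  then have lim_r: "((\<lambda>t. measure bridge_measure {f \<in> space bridge_measure. \<bar>X t f - zr\<bar> > \<epsilon>}) \<longlongrightarrow> 0) (at_right r)"
    if "\<epsilon> > 0" for \<epsilon>
    using limit_r[OF that] by (intro bridge_limit)
  have "\<forall>\<^sub>F t in at_left v. t \<in> {r<..<v}"
    using \<open>r < v\<close> by (auto simp: eventually_at_left_field)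
  then have lim_v: "((\<lambda>t. measure bridge_measure {f \<in> space bridge_measure. \<bar>X t f - zv\<bar> > \<epsilon>}) \<longlongrightarrow> 0) (at_left v)"
    if "\<epsilon> > 0" for \<epsilon>
    using limit_v[OF that] by (intro bridge_limit)
  have subset: "{r<..<v} \<subseteq> T"
    by (auto intro!: in_T)
  have "is_bridge \<Omega> T Z r zr v zv bridge_measure X"
    unfolding is_bridge_def
  proof (intro conjI allI impI)
    fix J :: "real set"
    assume "finite J \<and> J \<noteq> {} \<and> J \<subseteq> {r<..<v}"
    then show "absolutely_continuous (distr \<Omega> (PiM J (\<lambda>_. borel)) (at_times Z J))
        (distr bridge_measure (PiM J (\<lambda>_. borel)) (at_times X J))"
      by (intro absolutely_continuous_bridge) auto
  next
    fix S J U g h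
    assume *: "finite S \<and> finite J \<and> finite U \<and> S \<noteq> {} \<and> J \<noteq> {} \<and> U \<noteq> {} \<and>
        S \<union> J \<union> U \<subseteq> {r<..<v} \<and>
        (\<forall>s\<in>S. \<forall>t\<in>J. s < t) \<and> (\<forall>t\<in>J. \<forall>u\<in>U. t < u) \<and>
        g \<in> borel_measurable (PiM J (\<lambda>_. borel)) \<and>
        h \<in> borel_measurable (PiM S (\<lambda>_. borel) \<Otimes>\<^sub>M PiM U (\<lambda>_. borel)) \<and>
        integrable \<Omega> (\<lambda>\<omega>. g (at_times Z J \<omega>)) \<and>
        (AE \<omega> in \<Omega>. real_cond_exp \<Omega> (sigma_gen \<Omega> Z (S \<union> U)) (\<lambda>\<omega>. g (at_times Z J \<omega>)) \<omega> =
                    (h (at_times Z S \<omega>, at_times Z U \<omega>) :: real))"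
    show "AE f in bridge_measure. real_cond_exp bridge_measure (sigma_gen bridge_measure X (S \<union> U))
        (\<lambda>f. g (at_times X J f)) f = h (at_times X S f, at_times X U f)"
      by (rule bridge_real_cond_exp; use * in blast)
  next
    show "((\<lambda>t. measure bridge_measure {f \<in> space bridge_measure. \<bar>X t f - zr\<bar> > \<epsilon>}) \<longlongrightarrow> 0) (at_right r)"
      if "\<epsilon> > 0" for \<epsilon>
      using that by (rule lim_r)
    show "((\<lambda>t. measure bridge_measure {f \<in> space bridge_measure. \<bar>X t f - zv\<bar> > \<epsilon>}) \<longlongrightarrow> 0) (at_left v)"
      if "\<epsilon> > 0" for \<epsilon>
      using that by (rule lim_v)
  qed (fact \<open>r < v\<close> | fact subset | fact real_process_bridge)+
  with markov_process_bridge show ?thesis by blast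
qed

end
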